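(* There exists a linearly block gluing aperiodic $\mathbb{Z}^2$-subshift of finite type.
   Context: Let $\mathcal{A}$ be a finite alphabet; $\mathcal{A}^{\mathbb{Z}^2}$ carries the product of the discrete topologies, and the shift is $(\sigma^{u}x)_{v}=x_{u+v}$ for $u,v\in\mathbb{Z}^2$. A $\mathbb{Z}^2$-subshift is a nonempty compact subset $X\subset\mathcal{A}^{\mathbb{Z}^2}$ with $\sigma^{u}X\subset X$ for all $u\in\mathbb{Z}^2$. It is of finite type (SFT) if it is the set of configurations in which no translate of a pattern from some fixed finite set of patterns on finite supports appears. It is aperiodic if $\sigma^{u}(x)\neq x$ for all $x\in X$ and all $u\in\mathbb{Z}^2\setminus\{(0,0)\}$. An $n$-block is an element of $\mathcal{A}^{\{0,\dots,n-1\}^2}$; it is in the language of $X$ if it appears in a configuration of $X$. For $n$-blocks $p,q$ in the language of $X$, the gluing set of $p$ relative to $q$ is $$\Delta_X(p,q)=\{u\in\mathbb{Z}^2:\ \exists x\in X,\ x_{\{0,\dots,n-1\}^2}=q\ \text{and}\ x_{u+\{0,\dots,n-1\}^2}=p\}.$$ For a non-decreasing $f:\mathbb{N}\to\mathbb{N}$, $X$ is $f$-block gluing if for every $n$ and all $n$-blocks $p,q$ in the language of $X$, every $u\in\mathbb{Z}^2$ with $\|u\|_\infty\ge n+f(n)$ belongs to $\Delta_X(p,q)$. $X$ is linearly block gluing if it is $g$-block gluing for some $g:\mathbb{N}\to\mathbb{N}$ for which there is $C>0$ with $g(n)\le Cn$ for all $n$. *)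

theory Defs
  imports "HOL-Analysis.Analysis"
begin

type_synonym site = "int \<times> int"
type_synonym 'a config = "site \<Rightarrow> 'a"

definition shift :: "site \<Rightarrow> 'a config \<Rightarrow> 'a config" where
  "shift u x = (\<lambda>v. x (u + v))"

definition full_shift_topology :: "'a set \<Rightarrow> 'a config topology" where
  "full_shift_topology A = product_topology (\<lambda>_. discrete_topology A) UNIV"

text \<open>Compactness in the full shift includes \<open>X \<subseteq> UNIV \<rightarrow>\<^sub>E A\<close>.\<close>

definition subshift :: "'a set \<Rightarrow> 'a config set \<Rightarrow> bool" where
  "subshift A X \<longleftrightarrow>
     finite A \<and> X \<noteq> {} \<and> compactin (full_shift_topology A) X \<and> (\<forall>u. shift u ` X \<subseteq> X)"

text \<open>A pattern on the support \<open>S\<close> is an extensional function \<open>p \<in> S \<rightarrow>\<^sub>E A\<close>.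
  \<open>occurs S p u x\<close> says that \<open>x\<close> restricted to \<open>u + S\<close> is the translate of \<open>p\<close> by \<open>u\<close>.\<close>

definition occurs :: "site set \<Rightarrow> 'a config \<Rightarrow> site \<Rightarrow> 'a config \<Rightarrow> bool" where
  "occurs S p u x \<longleftrightarrow> restrict (shift u x) S = p"

definition finite_type :: "'a set \<Rightarrow> 'a config set \<Rightarrow> bool" where
  "finite_type A X \<longleftrightarrow>
     (\<exists>F. finite F \<and> (\<forall>(S, p) \<in> F. finite S \<and> p \<in> S \<rightarrow>\<^sub>E A) \<and>
          X = {x \<in> UNIV \<rightarrow>\<^sub>E A. \<forall>(S, p) \<in> F. \<forall>u. \<not> occurs S p u x})"

definition aperiodic :: "'a config set \<Rightarrow> bool" where
  "aperiodic X \<longleftrightarrow> (\<forall>x \<in> X. \<forall>u. u \<noteq> (0, 0) \<longrightarrow> shift u x \<noteq> x)"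

definition block_support :: "nat \<Rightarrow> site set" where
  "block_support n = {0..<int n} \<times> {0..<int n}"

definition block_language :: "'a config set \<Rightarrow> nat \<Rightarrow> 'a config set" where
  "block_language X n = {p. \<exists>x \<in> X. \<exists>u. occurs (block_support n) p u x}"

definition gluing_set :: "'a config set \<Rightarrow> nat \<Rightarrow> 'a config \<Rightarrow> 'a config \<Rightarrow> site set" where
  "gluing_set X n p q = {u. \<exists>x \<in> X. occurs (block_support n) q (0, 0) x \<and> occurs (block_support n) p u x}"

text \<open>The norm that the library puts on product types is Euclidean.\<close>

definition sup_norm :: "site \<Rightarrow> int" where
  "sup_norm u = max \<bar>fst u\<bar> \<bar>snd u\<bar>"

definition block_gluing :: "(nat \<Rightarrow> nat) \<Rightarrow> 'a config set \<Rightarrow> bool" where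
  "block_gluing f X \<longleftrightarrow>
     (\<forall>n. \<forall>p \<in> block_language X n. \<forall>q \<in> block_language X n. \<forall>u.
        int (n + f n) \<le> sup_norm u \<longrightarrow> u \<in> gluing_set X n p q)"

definition linearly_block_gluing :: "'a config set \<Rightarrow> bool" where
  "linearly_block_gluing X \<longleftrightarrow>
     (\<exists>g. mono g \<and> block_gluing g X \<and> (\<exists>C::real. C > 0 \<and> (\<forall>n. real (g n) \<le> C * real n)))"

end

theory Submission
  imports Defs
begin

text \<open>
  Start from an SFT of valid tilings with a Robinson-like 2-adic hierarchy: restricting a valid tiling
  to a suitable coset of \<open>2\<int> \<times> 2\<int>\<close> gives a valid tiling again, and the tiling is determined by this restriction.
  Hence periods can be halved forever, so there are none, and every square of side \<open>2 ^ m\<close> of a valid tiling recurs in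
  one fixed tiling along a coset of \<open>2 ^ (m + 5) \<int>\<^sup>2\<close>.

  Two blocks of a tiling can therefore be glued whenever their offset lies in a coset of a square lattice whose
  period is linear in the size. To reach all offsets, the tiling is read through distorted coordinates: a configuration
  shows at \<open>v\<close> the tile at position \<open>(f v div 5, g v div 5)\<close>, together with \<open>f v\<close> and \<open>g v\<close> modulo 110, where
  \<open>f\<close> and \<open>g\<close> satisfy one-sided Lipschitz conditions that make \<open>(f, g)\<close> expanding. Local rules recover \<open>f\<close>, \<open>g\<close> and
  the tiling, so nothing of aperiodicity is lost. Lipschitz functions on two distant blocks
  extend to a common one up to an additive constant from an interval of length linear in the distance,
  and such an interval meets every prescribed residue class.
\<close>

section \<open>A hierarchical tiling\<close>

text \<open>With \<open>v\<close> the 2-adic valuation, the symbol at \<open>(i, k)\<close> of the ideal configuration consists of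
  \<open>cm = sgn (v i - v k)\<close>, the digits \<open>ca = i / 2 ^ v i mod 4\<close> and \<open>cb = k / 2 ^ v k mod 4\<close>,
  and the phases \<open>cp = \<lfloor>i / 2 ^ v k\<rfloor> mod 4\<close> and \<open>cq = \<lfloor>k / 2 ^ v i\<rfloor> mod 4\<close>.
  Column digits are transmitted vertically and row digits horizontally; the horizontal phase of a row
  advances exactly at the columns of at least its own level.\<close>

datatype sym = Sym (cm: int) (ca: int) (cb: int) (cp: int) (cq: int)

definition cell :: "sym \<Rightarrow> bool" where
  "cell s \<longleftrightarrow> cm s \<in> {-1, 0, 1} \<and> ca s \<in> {1, 3} \<and> cb s \<in> {1, 3} \<and>
     cp s \<in> {0, 1, 2, 3} \<and> cq s \<in> {0, 1, 2, 3} \<and>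
     (cm s = 0 \<longrightarrow> cp s = ca s \<and> cq s = cb s) \<and>
     (cm s = 1 \<longrightarrow> cp s \<in> {0, 2} \<and> (cp s = 2 \<longrightarrow> cq s mod 2 = (cb s - 1) div 2)) \<and>
     (cm s = -1 \<longrightarrow> cq s \<in> {0, 2} \<and> (cq s = 2 \<longrightarrow> cp s mod 2 = (ca s - 1) div 2))"

definition hrule :: "sym \<Rightarrow> sym \<Rightarrow> bool" where
  "hrule s t \<longleftrightarrow> cb t = cb s \<and> cp t = (cp s + of_bool (cm t \<noteq> -1)) mod 4"

definition vrule :: "sym \<Rightarrow> sym \<Rightarrow> bool" where
  "vrule s t \<longleftrightarrow> ca t = ca s \<and> cq t = (cq s + of_bool (cm t \<noteq> 1)) mod 4"

definition valid :: "sym config \<Rightarrow> bool" where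
  "valid x \<longleftrightarrow> (\<forall>i k. cell (x (i, k)) \<and> hrule (x (i, k)) (x (i + 1, k)) \<and>
     vrule (x (i, k)) (x (i, k + 1)) \<and> (odd i \<and> odd k \<longrightarrow> cm (x (i, k)) = 0))"

section \<open>Reflection in the diagonal and first consequences of the rules\<close>

definition flip :: "sym \<Rightarrow> sym" where
  "flip s = Sym (- cm s) (cb s) (ca s) (cq s) (cp s)"

definition transposed :: "sym config \<Rightarrow> sym config" where
  "transposed x = (\<lambda>(i, k). flip (x (k, i)))"

lemma flip_sel [simp]:
  "cm (flip s) = - cm s" "ca (flip s) = cb s" "cb (flip s) = ca s" "cp (flip s) = cq s" "cq (flip s) = cp s"
  by (simp_all add: flip_def)

lemma transposed_apply [simp]: "transposed x (i, k) = flip (x (k, i))"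
  by (simp add: transposed_def)

lemma flip_flip [simp]: "flip (flip s) = s"
  by (cases s) (simp add: flip_def)

lemma cell_flip: "cell s \<Longrightarrow> cell (flip s)"
  unfolding cell_def by (elim conjE insertE emptyE) simp_all

lemma cell_cp_mod: "cell s \<Longrightarrow> cp s mod 4 = cp s"
  unfolding cell_def by (elim conjE insertE emptyE) simp_all

lemma cell_cq_mod: "cell s \<Longrightarrow> cq s mod 4 = cq s"
  unfolding cell_def by (elim conjE insertE emptyE) simp_all

lemma hrule_flip: "hrule (flip s) (flip t) \<longleftrightarrow> vrule s t"
  and vrule_flip: "vrule (flip s) (flip t) \<longleftrightarrow> hrule s t"
  using minus_equation_iff[of "cm t" 1] minus_equation_iff[of "cm t" "-1"]
  unfolding hrule_def vrule_def by auto

lemma valid_transposed: "valid x \<Longrightarrow> valid (transposed x)"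
  unfolding valid_def by (simp add: cell_flip hrule_flip vrule_flip)

lemma
  assumes "valid x"
  shows valid_cell: "cell (x (i, k))"
    and valid_h: "hrule (x (i, k)) (x (i + 1, k))"
    and valid_v: "vrule (x (i, k)) (x (i, k + 1))"
    and valid_odd: "odd i \<Longrightarrow> odd k \<Longrightarrow> cm (x (i, k)) = 0"
  using assms unfolding valid_def by blast+

lemma int_const:
  fixes f :: "int \<Rightarrow> 'a"
  assumes "\<And>k. f (k + 1) = f k"
  shows "f k = f l"
proof -
  have "f k = f 0" for k
    by (induction k rule: int_induct[where k = 0]) (metis assms, metis assms, metis assms diff_add_cancel)
  then show ?thesis by metis
qed

lemma valid_ca_const: "valid x \<Longrightarrow> ca (x (i, k)) = ca (x (i, l))"
  by (rule int_const[of "\<lambda>k. ca (x (i, k))"]) (use valid_v vrule_def in blast)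

lemma valid_cb_const: "valid x \<Longrightarrow> cb (x (i, k)) = cb (x (j, k))"
  by (rule int_const[of "\<lambda>i. cb (x (i, k))"]) (use valid_h hrule_def in blast)

lemma valid_shift_even:
  assumes "valid x" "even a" "even b"
  shows "valid (\<lambda>(i, k). x (i + a, k + b))"
proof -
  have "cell (x (i + a, k + b)) \<and> hrule (x (i + a, k + b)) (x (i + 1 + a, k + b)) \<and>
     vrule (x (i + a, k + b)) (x (i + a, k + 1 + b)) \<and> (odd i \<and> odd k \<longrightarrow> cm (x (i + a, k + b)) = 0)" for i k
    using valid_cell[OF assms(1)] valid_h[OF assms(1), of "i + a" "k + b"] valid_v[OF assms(1), of "i + a" "k + b"]
      valid_odd[OF assms(1), of "i + a" "k + b"] assms(2,3) by (simp add: algebra_simps)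
  then show ?thesis by (simp add: valid_def)
qed

text \<open>The two neighbours in odd columns have odd phases, and entering the right one advances
  the phase by one, so the phase at \<open>(i, k)\<close> is even. A cell with \<open>cm = 0\<close>
  would have an odd phase, and one with \<open>cm = -1\<close> would keep the odd phase of its left
  neighbour.\<close>

lemma valid_cm_even_odd:
  assumes x: "valid x" and "even i" "odd k"
  shows "cm (x (i, k)) = 1"
proof -
  have "cm (x (i - 1, k)) = 0" "cm (x (i + 1, k)) = 0"
    using assms valid_odd[OF x] by simp_all
  then have "cp (x (i - 1, k)) \<in> {1, 3}" "cp (x (i + 1, k)) \<in> {1, 3}"
    using valid_cell[OF x, of "i - 1" k] valid_cell[OF x, of "i + 1" k] by (simp_all add: cell_def)
  moreover have "cp (x (i, k)) = (cp (x (i - 1, k)) + of_bool (cm (x (i, k)) \<noteq> -1)) mod 4"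
    using valid_h[OF x, of "i - 1" k] by (simp add: hrule_def)
  moreover have "cp (x (i + 1, k)) = (cp (x (i, k)) + 1) mod 4"
    using valid_h[OF x, of i k] \<open>cm (x (i + 1, k)) = 0\<close> by (simp add: hrule_def)
  moreover have "cm (x (i, k)) \<in> {-1, 0, 1}" "cm (x (i, k)) = 0 \<Longrightarrow> cp (x (i, k)) \<in> {1, 3}"
    using valid_cell[OF x, of i k] by (simp_all add: cell_def)
  ultimately show ?thesis
    by (elim insertE emptyE) simp_all
qed

lemma valid_cm_odd_even:
  assumes "valid x" "odd i" "even k"
  shows "cm (x (i, k)) = -1"
  using valid_cm_even_odd[OF valid_transposed, OF assms(1,3,2)] by simp

section \<open>Normal tilings and reduction to the even sublattice\<close>

text \<open>The rules determine the digits of the odd lines only up to adding 2 modulo 4; fixing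
  them at \<open>(1, 1)\<close> makes them \<open>i mod 4\<close> and
  \<open>k mod 4\<close>.\<close>

definition normal :: "sym config \<Rightarrow> bool" where
  "normal x \<longleftrightarrow> valid x \<and> ca (x (1, 1)) = 1 \<and> cb (x (1, 1)) = 1"

lemma normal_valid: "normal x \<Longrightarrow> valid x"
  by (simp add: normal_def)

lemma normal_transposed: "normal x \<Longrightarrow> normal (transposed x)"
  by (simp add: normal_def valid_transposed)

text \<open>No cell of an odd row has \<open>cm = -1\<close>, so the phase advances at every step;
  at column 1 it equals the normalised digit.\<close>

lemma normal_cp_odd:
  assumes x: "normal x" and k: "odd k"
  shows "cp (x (i, k)) = i mod 4"
proof -
  note v = normal_valid[OF x]
  have "cm (x (i, k)) \<noteq> -1" for i
    using k valid_odd[OF v, of i k] valid_cm_even_odd[OF v, of i k] by (cases "even i") simp_all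
  then have step: "cp (x (i + 1, k)) = (cp (x (i, k)) + 1) mod 4" for i
    using valid_h[OF v, of i k] by (simp add: hrule_def)
  have "(cp (x (i, k)) - i) mod 4 = (cp (x (1, k)) - 1) mod 4"
    by (rule int_const[of "\<lambda>i. (cp (x (i, k)) - i) mod 4"]) (simp add: step mod_simps)
  also have "cp (x (1, k)) = ca (x (1, 1))"
    using valid_cell[OF v, of 1 k] valid_odd[OF v, of 1 k] k valid_ca_const[OF v, of 1 k 1] by (simp add: cell_def)
  finally have "4 dvd cp (x (i, k)) - i"
    using x by (simp add: normal_def dvd_eq_mod_eq_0)
  then have "cp (x (i, k)) mod 4 = i mod 4"
    by (simp add: mod_eq_dvd_iff)
  then show ?thesis
    using cell_cp_mod[OF valid_cell[OF v]] by simp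
qed

lemma normal_ca_odd:
  assumes x: "normal x" and i: "odd i"
  shows "ca (x (i, k)) = i mod 4"
proof -
  note v = normal_valid[OF x]
  have "ca (x (i, k)) = cp (x (i, 1))"
    using valid_ca_const[OF v, of i k 1] valid_cell[OF v, of i 1] valid_odd[OF v, of i 1] i by (simp add: cell_def)
  then show ?thesis using normal_cp_odd[OF x, of 1] by simp
qed

lemma normal_cq_odd: "normal x \<Longrightarrow> odd i \<Longrightarrow> cq (x (i, k)) = k mod 4"
  using normal_cp_odd[OF normal_transposed] by fastforce

lemma normal_cb_odd: "normal x \<Longrightarrow> odd k \<Longrightarrow> cb (x (i, k)) = k mod 4"
  using normal_ca_odd[OF normal_transposed] by fastforce

lemma valid_cp_even_row:
  assumes "valid x" "even k" "even i"
  shows "cp (x (i + 1, k)) = cp (x (i, k))"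
  using valid_h[of x i k] valid_cm_odd_even[of x "i + 1" k] cell_cp_mod[OF valid_cell, of x i k] assms
  by (simp add: hrule_def)

lemma valid_cq_even_col:
  assumes "valid x" "even i" "even k"
  shows "cq (x (i, k + 1)) = cq (x (i, k))"
  using valid_cp_even_row[OF valid_transposed, OF assms] by simp

definition deflate :: "sym config \<Rightarrow> sym config" where
  "deflate x = (\<lambda>(i, k). x (2 * i, 2 * k))"

lemma deflate_apply [simp]: "deflate x (i, k) = x (2 * i, 2 * k)"
  by (simp add: deflate_def)

text \<open>Inverse of \<open>deflate\<close> on normal tilings: the missing entries are forced by
  the position modulo 4 and by the entry at the preceding even position.\<close>

definition inflate :: "sym config \<Rightarrow> sym config" where
  "inflate x = (\<lambda>(i, k).
     if even i then
       if even k then x (i div 2, k div 2)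
       else let s = x (i div 2, k div 2) in Sym 1 (ca s) (k mod 4) (i mod 4) (cq s)
     else
       if even k then let s = x (i div 2, k div 2) in Sym (-1) (i mod 4) (cb s) (cp s) (k mod 4)
       else Sym 0 (i mod 4) (k mod 4) (i mod 4) (k mod 4))"

lemma inflate_deflate:
  assumes x: "normal x"
  shows "inflate (deflate x) = x"
proof (rule ext, clarify)
  fix i k :: int
  note v = normal_valid[OF x]
  show "inflate (deflate x) (i, k) = x (i, k)"
  proof (cases "even i"; cases "even k")
    assume "even i" "even k" then show ?thesis by (simp add: inflate_def)
  next
    assume ik: "even i" "odd k"
    then have "k = 2 * (k div 2) + 1" "i = 2 * (i div 2)" by simp_all
    then show ?thesis
      using ik valid_cq_even_col[OF v, of i "2 * (k div 2)"] valid_ca_const[OF v, of i "2 * (k div 2)" k]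
        normal_cp_odd[OF x, of k i] normal_cb_odd[OF x, of k i] valid_cm_even_odd[OF v, of i k]
      by (simp add: inflate_def sym.expand)
  next
    assume ik: "odd i" "even k"
    then have "i = 2 * (i div 2) + 1" "k = 2 * (k div 2)" by simp_all
    then show ?thesis
      using ik valid_cp_even_row[OF v, of k "2 * (i div 2)"] valid_cb_const[OF v, of "2 * (i div 2)" k i]
        normal_cq_odd[OF x, of i k] normal_ca_odd[OF x, of i k] valid_cm_odd_even[OF v, of i k]
      by (simp add: inflate_def sym.expand)
  next
    assume "odd i" "odd k"
    then show ?thesis
      using x v by (simp add: inflate_def sym.expand normal_cp_odd normal_cq_odd normal_ca_odd normal_cb_odd valid_odd)
  qed
qed

text \<open>The condition on cells with phase 2 acts as the side of a Robinson square: it points outwards.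
  It makes the vertical phase advance between the two neighbouring odd rows, so the cell in the
  middle cannot be dominated by its column.\<close>

lemma deflate_not_1:
  assumes x: "normal x" and "odd i" "odd k"
  shows "cm (x (2 * i, 2 * k)) \<noteq> 1"
proof
  note v = normal_valid[OF x]
  assume c: "cm (x (2 * i, 2 * k)) = 1"
  have *: "cq (x (2 * i, l)) mod 2 = (l mod 4 - 1) div 2" if "odd l" for l
    using valid_cell[OF v, of "2 * i" l] valid_cm_even_odd[OF v, of "2 * i" l] that \<open>odd i\<close>
      normal_cp_odd[OF x, of l "2 * i"] normal_cb_odd[OF x, of l "2 * i"]
    by (simp add: cell_def mod_mult_mult1[of 2 i 2, simplified] odd_iff_mod_2_eq_one)
  have "cq (x (2 * i, 2 * k + 1)) = cq (x (2 * i, 2 * k - 1))"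
    using valid_cq_even_col[OF v, of "2 * i" "2 * k"] valid_v[OF v, of "2 * i" "2 * k - 1"] c
      cell_cq_mod[OF valid_cell[OF v, of "2 * i" "2 * k - 1"]]
    by (simp add: vrule_def)
  then have "((2 * k + 1) mod 4 - 1) div 2 = ((2 * k - 1) mod 4 - 1) div 2"
    using *[of "2 * k + 1"] *[of "2 * k - 1"] by simp
  then show False using \<open>odd k\<close> by presburger
qed

text \<open>Two steps along an even row pass one odd column, where the phase does not advance, so
  the rules descend to the sublattice. At odd coarse positions, \<open>deflate_not_1\<close> and its
  transpose leave only \<open>cm = 0\<close>.\<close>

lemma valid_deflate:
  assumes x: "normal x"
  shows "valid (deflate x)"
proof -
  note v = normal_valid[OF x]
  have h: "hrule (x (2 * i, 2 * k)) (x (2 * (i + 1), 2 * k))" if v: "valid x" for x i k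
    using valid_cp_even_row[OF v, of "2 * k" "2 * i"] valid_h[OF v, of "2 * i + 1" "2 * k"]
      valid_cb_const[OF v, of "2 * i" "2 * k" "2 * i + 2"]
    by (simp add: hrule_def algebra_simps)
  have "cm (x (2 * i, 2 * k)) = 0" if "odd i" "odd k" for i k
    using deflate_not_1[OF x that] deflate_not_1[OF normal_transposed[OF x] that(2,1)] valid_cell[OF v, of "2 * i" "2 * k"]
    by (auto simp: cell_def)
  moreover have "vrule (x (2 * i, 2 * k)) (x (2 * i, 2 * (k + 1)))" for i k
    using h[OF valid_transposed[OF v], of k i] by (simp add: hrule_flip)
  ultimately show ?thesis
    using v h[OF v] by (simp add: valid_def)
qed

text \<open>The digits of columns 1 and 3 differ by 2 modulo 4, so one of them is 1, and likewise
  for rows.\<close>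

lemma valid_normalise:
  assumes x: "valid x"
  obtains a b where "even a" "even b" "normal (\<lambda>(i, k). x (i + a, k + b))"
proof -
  have 1: "\<exists>a. even a \<and> ca (x (1 + a, 1)) = 1" if x: "valid x" for x
  proof -
    have "ca (x (1, 1)) = cp (x (1, 1))" "ca (x (3, 1)) = cp (x (3, 1))"
      using valid_cell[OF x, of 1 1] valid_odd[OF x, of 1 1] valid_cell[OF x, of 3 1] valid_odd[OF x, of 3 1]
      by (simp_all add: cell_def)
    moreover have "cp (x (3, 1)) = (cp (x (1, 1)) + 2) mod 4"
      using valid_h[OF x, of 1 1] valid_h[OF x, of 2 1] valid_odd[OF x, of 3 1] valid_cm_even_odd[OF x, of 2 1]
      by (simp add: hrule_def mod_simps add.commute)
    moreover have "ca (x (1, 1)) \<in> {1, 3}"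
      using valid_cell[OF x, of 1 1] by (simp add: cell_def)
    ultimately have "ca (x (1 + 0, 1)) = 1 \<or> ca (x (1 + 2, 1)) = 1"
      by (elim insertE emptyE) simp_all
    then show ?thesis by (metis dvd_0_right dvd_refl)
  qed
  obtain a where a: "even a" "ca (x (1 + a, 1)) = 1" using 1[OF x] by blast
  obtain b where b: "even b" "cb (x (1, 1 + b)) = 1" using 1[OF valid_transposed[OF x]] by auto
  have "normal (\<lambda>(i, k). x (i + a, k + b))"
    using valid_shift_even[OF x a(1) b(1)] a b valid_ca_const[OF x, of "1 + a" "1 + b" 1]
      valid_cb_const[OF x, of "1 + a" "1 + b" 1]
    by (simp add: normal_def)
  then show ?thesis using that a b by blast
qed

section \<open>Absence of periods\<close>

definition periodic_by :: "'a config \<Rightarrow> int \<Rightarrow> int \<Rightarrow> bool" where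
  "periodic_by x a b \<longleftrightarrow> (\<forall>i k. x (i + a, k + b) = x (i, k))"

text \<open>On the three parity classes other than even-even, \<open>cm\<close> takes three
  different constant values. A translation with an odd component always carries one of these classes
  to another.\<close>

lemma valid_period_even:
  assumes x: "valid x" and p: "periodic_by x a b"
  shows "even a \<and> even b"
proof -
  note p' = p[unfolded periodic_by_def, rule_format]
  have "cm (x (1 + a, 1 + b)) = 0" "cm (x (1 + a, b)) = -1" "cm (x (a, 1 + b)) = 1"
    using p'[of 1 1] p'[of 1 0] p'[of 0 1]
      valid_odd[OF x, of 1 1] valid_cm_even_odd[OF x, of 0 1] valid_cm_odd_even[OF x, of 1 0]
    by simp_all
  then show ?thesis
    using valid_odd[OF x, of "1 + a" "b"] valid_odd[OF x, of a "1 + b"] valid_odd[OF x, of "1 + a" "1 + b"]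
      valid_cm_even_odd[OF x, of "1 + a" "1 + b"] valid_cm_odd_even[OF x, of "1 + a" "1 + b"]
      valid_cm_even_odd[OF x, of "1 + a" b]
    by (cases "even a"; cases "even b") auto
qed

lemma valid_aperiodic:
  assumes "valid x" "periodic_by x a b"
  shows "a = 0 \<and> b = 0"
  using assms
proof (induction "nat (\<bar>a\<bar> + \<bar>b\<bar>)" arbitrary: x a b rule: less_induct)
  case less
  obtain a' b' where ab: "a = 2 * a'" "b = 2 * b'"
    using valid_period_even[OF less.prems] by (auto elim!: evenE)
  obtain s t where y: "normal (\<lambda>(i, k). x (i + s, k + t))" (is "normal ?y")
    using valid_normalise[OF less.prems(1)] by metis
  have "periodic_by (deflate ?y) a' b'"
    unfolding periodic_by_def
  proof (intro allI)
    fix i k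
    have "x ((2 * i + s) + a, (2 * k + t) + b) = x (2 * i + s, 2 * k + t)"
      using less.prems(2) by (simp only: periodic_by_def)
    then show "deflate ?y (i + a', k + b') = deflate ?y (i, k)"
      by (simp add: ab algebra_simps)
  qed
  then show ?case
    using less.hyps[OF _ valid_deflate[OF y], of a' b'] ab by fastforce
qed

section \<open>The ideal configuration\<close>

text \<open>The origin stands for the value \<open>v 0 = \<infinity>\<close>, with digit 1 in both coordinates.\<close>

function yc :: "int \<Rightarrow> int \<Rightarrow> int" where
  "yc i k = (if i = 0 \<and> k = 0 then 0
     else if odd i then (if odd k then 0 else -1)
     else if odd k then 1 else yc (i div 2) (k div 2))"
  by pat_completeness auto
termination
  by (relation "Wellfounded.measure (\<lambda>(i, k). nat (\<bar>i\<bar> + \<bar>k\<bar>))") (auto elim!: evenE)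

function ya :: "int \<Rightarrow> int" where
  "ya i = (if i = 0 then 1 else if odd i then i mod 4 else ya (i div 2))"
  by pat_completeness auto
termination
  by (relation "Wellfounded.measure (\<lambda>i. nat \<bar>i\<bar>)") (auto elim!: evenE)

text \<open>In row 0 only column 0 advances the phase, hence the jump from 0 to 1 there; the value 1
  agrees with the digit of the origin.\<close>

function yp :: "int \<Rightarrow> int \<Rightarrow> int" where
  "yp i k = (if k = 0 then of_bool (0 \<le> i) else if odd k then i mod 4 else yp (i div 2) (k div 2))"
  by pat_completeness auto
termination
  by (relation "Wellfounded.measure (\<lambda>(i, k). nat \<bar>k\<bar>)") (auto elim!: evenE)

declare yc.simps [simp del] ya.simps [simp del] yp.simps [simp del]

lemma yc_simps [simp]:
  "yc (2 * i) (2 * k) = yc i k"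
  "odd i \<Longrightarrow> odd k \<Longrightarrow> yc i k = 0"
  "odd i \<Longrightarrow> even k \<Longrightarrow> yc i k = -1"
  "even i \<Longrightarrow> odd k \<Longrightarrow> yc i k = 1"
  by (subst yc.simps; simp; subst yc.simps; simp) (subst yc.simps; auto)+

lemma ya_simps [simp]: "ya (2 * i) = ya i" "odd i \<Longrightarrow> ya i = i mod 4"
  by (subst ya.simps; simp; subst ya.simps; simp) (subst ya.simps; auto)+

lemma yp_simps [simp]:
  "yp i (2 * k) = yp (i div 2) k" "odd k \<Longrightarrow> yp i k = i mod 4" "yp i 0 = of_bool (0 \<le> i)"
  by (subst yp.simps; simp; subst yp.simps; simp) (subst yp.simps; auto)+

definition ystar :: "sym config" where
  "ystar = (\<lambda>(i, k). Sym (yc i k) (ya i) (ya k) (yp i k) (yp k i))"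

lemma ystar_apply: "ystar (i, k) = Sym (yc i k) (ya i) (ya k) (yp i k) (yp k i)"
  by (simp add: ystar_def)

lemma ystar_double: "ystar (2 * i, 2 * k) = ystar (i, k)"
  by (simp add: ystar_apply)

lemma yc_swap: "yc k i = - yc i k"
proof (induction i k rule: yc.induct)
  case (1 i k)
  show ?case
  proof (cases "i = 0 \<and> k = 0 \<or> odd i \<or> odd k")
    case True
    then show ?thesis by (cases "even i"; cases "even k") (auto simp: yc.simps)
  next
    case False
    then have "yc (k div 2) (i div 2) = - yc (i div 2) (k div 2)" using 1 by blast
    then show ?thesis
      using False yc_simps(1)[of "i div 2" "k div 2"] yc_simps(1)[of "k div 2" "i div 2"] by simp
  qed
qed

lemma flip_ystar: "flip (ystar (i, k)) = ystar (k, i)"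
  using yc_swap[of k i] by (simp add: ystar_apply flip_def)

text \<open>Self-similarity: an occurrence of a square of a reduced tiling in \<open>ystar\<close>
  lifts to an occurrence of the larger square.\<close>

lemma inflate_ystar: "inflate ystar = ystar"
proof (rule ext, clarify)
  fix i k :: int
  show "inflate ystar (i, k) = ystar (i, k)"
    using ya_simps(1)[of "i div 2"] ya_simps(1)[of "k div 2"] yp_simps(1)[of i "k div 2"] yp_simps(1)[of k "i div 2"]
      yc_simps(1)[of "i div 2" "k div 2"]
    by (cases "even i"; cases "even k") (simp_all add: inflate_def ystar_apply Let_def)
qed

lemma cell_ystar_odd:
  assumes k: "odd k"
  shows "cell (ystar (i, k))"
proof (cases "even i")
  case True
  then obtain j where i: "i = 2 * j" by (elim evenE)
  have "ya n \<in> {1, 3}" for n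
  proof (induction n rule: ya.induct)
    case (1 n)
    have "odd n \<Longrightarrow> n mod 4 \<in> {1, 3}" by (auto; presburger)
    then show ?case using 1 by (subst ya.simps) auto
  qed
  moreover have "yp n m \<in> {0, 1, 2, 3}" for n m
  proof (induction n m rule: yp.induct)
    case (1 n m)
    have "n mod 4 \<in> {0, 1, 2, 3}" by (auto; presburger)
    then show ?case using 1 by (subst yp.simps) auto
  qed
  moreover have "i mod 4 \<in> {0, 2}" using i by (auto; presburger)
  moreover have "k mod 4 \<in> {1, 3}" using k by (auto; presburger)
  \<comment> \<open>The column has level 1 here, so the phase is \<open>k div 2\<close> modulo 4,
    whose parity is the second binary digit of \<open>k\<close>.\<close>
  moreover have "yp k i mod 2 = (k mod 4 - 1) div 2" if "i mod 4 = 2"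
  proof -
    have "odd j" using i that by presburger
    then have "yp k i mod 2 = k div 2 mod 2" by (simp add: i mod_mod_cancel)
    also have "\<dots> = (k mod 4 - 1) div 2"
    proof -
      obtain l where "k = 2 * l + 1" using k by (elim oddE)
      then show ?thesis by (simp add: mod_mult_mult1 flip: mult_2) presburger
    qed
    finally show ?thesis .
  qed
  ultimately show ?thesis
    using True k by (auto simp: cell_def ystar_apply)
next
  case False
  have "odd n \<Longrightarrow> n mod 4 \<in> {1, 3}" for n :: int by (auto; presburger)
  then show ?thesis using False k by (auto simp: cell_def ystar_apply)
qed

lemma cell_ystar: "cell (ystar (i, k))"
proof (induction i k rule: yc.induct)
  case (1 i k)
  consider "i = 0" "k = 0" | "odd k" | "odd i" | "\<not> (i = 0 \<and> k = 0)" "even i" "even k" by blast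
  then show ?case
  proof cases
    case 1
    then show ?thesis by (simp add: cell_def ystar_apply yc.simps[of 0 0] ya.simps[of 0])
  next
    case 2
    then show ?thesis by (rule cell_ystar_odd)
  next
    case 3
    then show ?thesis using cell_flip[OF cell_ystar_odd[of i k]] by (simp add: flip_ystar)
  next
    case 4
    then have "cell (ystar (i div 2, k div 2))" using 1 by blast
    then show ?thesis using 4 ystar_double[of "i div 2" "k div 2"] by simp
  qed
qed

lemma yc_0: "yc i 0 = (if i = 0 then 0 else -1)"
proof (induction i rule: ya.induct)
  case (1 i)
  then show ?case using yc_simps(1)[of "i div 2" 0] by (cases "even i") (auto simp: yc.simps[of 0 0])
qed

text \<open>For even \<open>k \<noteq> 0\<close> and even \<open>i\<close>, the odd column
  \<open>i + 1\<close> has lower level than the row and nothing advances; for odd \<open>i\<close>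
  the step is a step of the halved configuration.\<close>

lemma yp_step: "yp (i + 1) k = (yp i k + of_bool (yc (i + 1) k \<noteq> -1)) mod 4"
proof (induction i k rule: yp.induct)
  case (1 i k)
  consider "k = 0" | "odd k" | l where "k \<noteq> 0" "k = 2 * l" by (metis evenE)
  then show ?case
  proof cases
    case 1 then show ?thesis by (auto simp: yc_0)
  next
    case 2 then show ?thesis by (cases "even i") (simp_all add: mod_simps)
  next
    case (3 l)
    show ?thesis
    proof (cases "even i")
      case True
      then have "(i + 1) div 2 = i div 2" by presburger
      moreover have "yp n m mod 4 = yp n m" for n m
        using cell_cp_mod[OF cell_ystar, of n m] by (simp add: ystar_apply)
      ultimately show ?thesis using True 3 by simp
    next
      case False
      then obtain j where i: "i + 1 = 2 * (j + 1)" by (metis even_plus_one_iff evenE diff_add_cancel)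
      then have ij: "i div 2 = j" by presburger
      have "yp (j + 1) l = (yp j l + of_bool (yc (j + 1) l \<noteq> -1)) mod 4"
        using 1 3 ij by simp
      moreover have "yc (i + 1) k = yc (j + 1) l" "yp (i + 1) k = yp (j + 1) l" "yp i k = yp j l"
        by (simp_all only: i ij 3 yc_simps yp_simps) simp
      ultimately show ?thesis by simp
    qed
  qed
qed

lemma valid_ystar: "valid ystar"
proof -
  have h: "hrule (ystar (i, k)) (ystar (i + 1, k))" for i k
    using yp_step[of i k] by (simp add: hrule_def ystar_apply)
  moreover have "vrule (ystar (i, k)) (ystar (i, k + 1))" for i k
    using h[of k i] hrule_flip[of "ystar (i, k)" "ystar (i, k + 1)"] by (simp add: flip_ystar)
  ultimately show ?thesis
    by (simp add: valid_def cell_ystar) (simp add: ystar_apply)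
qed

section \<open>Recurrence of squares in the ideal configuration\<close>

text \<open>A whole coset of translates is required at once: both the induction over sizes and the
  gluing move occurrences by multiples of \<open>N\<close>.\<close>

definition occurs_at :: "int \<Rightarrow> sym config \<Rightarrow> site set \<Rightarrow> site \<Rightarrow> bool" where
  "occurs_at N x Q w \<longleftrightarrow> (\<forall>a b. N dvd a - fst w \<longrightarrow> N dvd b - snd w \<longrightarrow>
     (\<forall>(i, k) \<in> Q. ystar (i + a, k + b) = x (i, k)))"

lemma occurs_atD:
  assumes "occurs_at N x Q w" "N dvd a - fst w" "N dvd b - snd w" "(i, k) \<in> Q"
  shows "ystar (i + a, k + b) = x (i, k)"
  using assms unfolding occurs_at_def by blast

text \<open>A position is read off from the symbol. The row has level 0; the column has level 0 if
  \<open>cm s = 0\<close>, level 1 for phase 2 and level 2 for phase 0. The binary digits of the row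
  position supply \<open>cb s\<close> and \<open>cq s\<close>.\<close>

lemma cell_realised_odd:
  assumes s: "cell s" and c: "cm s \<noteq> -1"
  obtains I K where "odd K" "even I \<longleftrightarrow> cm s = 1"
    "\<And>I' K'. 16 dvd I' - I \<Longrightarrow> 16 dvd K' - K \<Longrightarrow> ystar (I', K') = s"
proof -
  have ca: "ca s = 1 \<or> ca s = 3" and cb: "cb s = 1 \<or> cb s = 3" and cq': "cq s \<in> {0, 1, 2, 3}"
    using s unfolding cell_def by blast+
  have a4: "ca s mod 4 = ca s" and b4: "cb s mod 4 = cb s" and q4: "cq s mod 4 = cq s" and ab: "odd (ca s)" "odd (cb s)"
    using ca cb cell_cq_mod[OF s] by auto
  consider "cm s = 0" | "cm s = 1" "cp s = 2" | "cm s = 1" "cp s = 0"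
    using s c unfolding cell_def by blast
  then show thesis
  proof cases
    case 1
    show ?thesis
    \<comment> \<open>The row comes first in these instantiations, since \<open>odd K\<close> is the
      first premise of \<open>that\<close>.\<close>
    proof (rule that[of "cb s" "ca s"])
      fix I' K' assume m: "16 dvd I' - ca s" "16 dvd K' - cb s"
      obtain r q where "I' - ca s = 16 * r" "K' - cb s = 16 * q" using m unfolding dvd_def by blast
      then have I: "I' = ca s + 4 * (4 * r)" "K' = cb s + 4 * (4 * q)" by simp_all
      then have "I' mod 4 = ca s" "K' mod 4 = cb s" unfolding I mod_mult_self2 a4 b4 by simp_all
      moreover have "odd I'" "odd K'" using ab I by simp_all
      ultimately show "ystar (I', K') = s"
        using 1 s by (simp add: ystar_apply sym.expand cell_def)
    qed (use ab 1 in auto)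
  next
    case 2
    show ?thesis
    \<comment> \<open>The phase at level 1 is \<open>K div 2\<close>, here \<open>cq s\<close>; the
      parity condition in \<open>cell\<close> then makes \<open>K mod 4\<close> equal to
      \<open>cb s\<close>.\<close>
    proof (rule that[of "2 * cq s + 1" "2 * ca s"])
      fix I' K' assume m: "16 dvd I' - (2 * ca s)" "16 dvd K' - (2 * cq s + 1)"
      obtain r q where rq: "I' - 2 * ca s = 16 * r" "K' - (2 * cq s + 1) = 16 * q" using m unfolding dvd_def by blast
      define J where "J = ca s + 4 * (2 * r)"
      have I: "I' = 2 * J" using rq by (simp add: J_def)
      have J: "J mod 4 = ca s" "odd J" using ab unfolding J_def mod_mult_self2 a4 by simp_all
      have I4: "I' mod 4 = 2" using \<open>odd J\<close> unfolding I by presburger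
      have "cq s mod 2 = (cb s - 1) div 2" using s 2 by (simp add: cell_def)
      then have "(2 * cq s + 1) mod 4 = cb s" using cb by (elim disjE; simp; presburger)
      moreover have "K' = 2 * cq s + 1 + 4 * (4 * q)" using rq by simp
      ultimately have K4: "K' mod 4 = cb s" by (simp only: mod_mult_self2)
      have K: "K' = 2 * (cq s + 4 * (2 * q)) + 1" using rq by simp
      then have "K' div 2 = cq s + 4 * (2 * q)" "odd K'" by simp_all
      moreover have "ya I' = ca s" using J unfolding I ya_simps(1) by simp
      moreover have "yp K' I' = K' div 2 mod 4" using yp_simps(2)[OF J(2)] unfolding I yp_simps(1) by blast
      moreover have "(cq s + 4 * (2 * q)) mod 4 = cq s" unfolding mod_mult_self2 by (rule q4)
      moreover have "yc I' K' = 1" using \<open>odd K'\<close> I by simp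
      ultimately show "ystar (I', K') = s"
        using 2 I4 K4 by (intro sym.expand) (simp add: ystar_apply)
    qed (use 2 in auto)
  next
    case 3
    show ?thesis
    \<comment> \<open>The phase at level 2 is \<open>K div 4\<close>, here \<open>cq s\<close>,
      which leaves \<open>K mod 4\<close> free to be \<open>cb s\<close>.\<close>
    proof (rule that[of "4 * cq s + cb s" "4 * ca s"])
      fix I' K' assume m: "16 dvd I' - (4 * ca s)" "16 dvd K' - (4 * cq s + cb s)"
      obtain r q where rq: "I' - 4 * ca s = 16 * r" "K' - (4 * cq s + cb s) = 16 * q" using m unfolding dvd_def by blast
      define J where "J = ca s + 4 * r"
      have I: "I' = 2 * (2 * J)" using rq by (simp add: J_def)
      have J: "J mod 4 = ca s" "odd J" using ab unfolding J_def mod_mult_self2 a4 by simp_all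
      have K: "K' = cb s + 4 * (cq s + 4 * q)" using rq by simp
      have K4: "K' mod 4 = cb s" unfolding K mod_mult_self2 b4 by simp
      have "K' div 2 div 2 = K' div 4" by presburger
      also have "\<dots> = cq s + 4 * q" using cb K by auto
      finally have "(K' div 2 div 2) mod 4 = cq s" by (simp only: mod_mult_self2 q4)
      moreover have "yp K' I' = (K' div 2 div 2) mod 4" using yp_simps(2)[OF J(2)] unfolding I yp_simps(1) by blast
      ultimately have yq: "yp K' I' = cq s" by (simp only:)
      have ya: "ya I' = ca s" using J unfolding I ya_simps(1) by simp
      have oK: "odd K'" using K ab by simp
      have "yc I' K' = 1" "I' mod 4 = 0" using oK I by simp_all
      then show "ystar (I', K') = s"
        using 3 K4 oK yq ya by (intro sym.expand) (simp add: ystar_apply)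
    qed (use 3 ab in auto)
  qed
qed

text \<open>Offsets must be even. At an even-even site the position found for the symbol is doubled,
  which raises the period from 16 to 32; at other sites \<open>cm\<close> already fixes the
  parities.\<close>

lemma cell_realised:
  assumes x: "valid x"
  obtains I K where "even (I - i)" "even (K - k)"
    "\<And>I' K'. 32 dvd I' - I \<Longrightarrow> 32 dvd K' - K \<Longrightarrow> ystar (I', K') = x (i, k)"
proof -
  let ?s = "x (i, k)"
  have *: "\<exists>I K. (even I \<longleftrightarrow> cm s = 1) \<and> (even K \<longleftrightarrow> cm s = -1) \<and>
      (\<forall>I' K'. 16 dvd I' - I \<longrightarrow> 16 dvd K' - K \<longrightarrow> ystar (I', K') = s)" if s: "cell s" for s
  proof (cases "cm s = -1")
    case False
    then show ?thesis using cell_realised_odd[OF s False] by metis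
  next
    case True
    then have "cm (flip s) \<noteq> -1" "cm (flip s) = 1" by simp_all
    then obtain I K where IK: "odd K" "even I"
      "\<And>I' K'. 16 dvd I' - I \<Longrightarrow> 16 dvd K' - K \<Longrightarrow> ystar (I', K') = flip s"
      using cell_realised_odd[OF cell_flip[OF s]] by metis
    have "ystar (K', I') = s" if "16 dvd I' - I" "16 dvd K' - K" for I' K'
      using IK(3)[OF that] flip_ystar[of I' K'] by simp
    then show ?thesis using True IK(1,2) by (intro exI[of _ K] exI[of _ I]) auto
  qed
  obtain I K where IK: "even I \<longleftrightarrow> cm ?s = 1" "even K \<longleftrightarrow> cm ?s = -1"
      "\<And>I' K'. 16 dvd I' - I \<Longrightarrow> 16 dvd K' - K \<Longrightarrow> ystar (I', K') = ?s"
    using *[OF valid_cell[OF x]] by blast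
  show thesis
  proof (cases "even i \<and> even k")
    case True
    show thesis
    proof (rule that)
      fix I' K' assume "32 dvd I' - 2 * I" "32 dvd K' - 2 * K"
      then obtain r q where "I' - 2 * I = 32 * r" "K' - 2 * K = 32 * q" unfolding dvd_def by blast
      then have "I' = 2 * (I + 16 * r)" "K' = 2 * (K + 16 * q)" by simp_all
      then show "ystar (I', K') = ?s" using IK(3)[of "I + 16 * r" "K + 16 * q"] by (simp only: ystar_double) simp
    qed (use True in auto)
  next
    case False
    then have "even I \<longleftrightarrow> even i" "even K \<longleftrightarrow> even k"
      using IK(1,2) valid_odd[OF x, of i k] valid_cm_even_odd[OF x, of i k] valid_cm_odd_even[OF x, of i k]
      by (cases "even i"; cases "even k"; simp)+
    moreover have "ystar (I', K') = ?s" if "32 dvd I' - I" "32 dvd K' - K" for I' K'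
    proof (rule IK(3))
      have "(16::int) dvd 32" by simp
      then show "16 dvd I' - I" "16 dvd K' - K" using that dvd_trans by blast+
    qed
    ultimately show thesis using that[of I K] by simp
  qed
qed

definition square :: "int \<Rightarrow> int \<Rightarrow> int \<Rightarrow> site set" where
  "square a b N = {a..<a + N} \<times> {b..<b + N}"

text \<open>An odd row at the margin of the large square takes its data from whichever of the two adjacent
  even rows lies in the small square; the phases can be propagated in both directions.\<close>

lemma inflate_square:
  assumes x: "valid x" and y: "valid y" and p: "even p" "even q" and N: "0 < N"
    and eq: "\<And>i k. (i, k) \<in> square (- (- a div 2)) (- (- b div 2)) N \<Longrightarrow> y (i + p, k + q) = x (i, k)"
    and ik: "(i, k) \<in> square a b (2 * N)"
  shows "inflate y (i + 2 * p, k + 2 * q) = inflate x (i, k)"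
proof -
  have m: "(i + 2 * p) mod 4 = i mod 4" "(k + 2 * q) mod 4 = k mod 4" using p by (auto elim!: evenE)
  have d: "(i + 2 * p) div 2 = i div 2 + p" "(k + 2 * q) div 2 = k div 2 + q" by simp_all
  let ?B = "square (- (- a div 2)) (- (- b div 2)) N"
  have col: "ca (y (i' + p, k' + q)) = ca (x (i', k')) \<and> cq (y (i' + p, k' + q)) = cq (x (i', k'))"
    if k': "(i', k') \<in> ?B \<or> (i', k' + 1) \<in> ?B" for i' k'
    using k'
  proof
    assume "(i', k') \<in> ?B" then show ?thesis using eq by simp
  next
    assume "(i', k' + 1) \<in> ?B"
    then have e: "y (i' + p, k' + q + 1) = x (i', k' + 1)" using eq[of i' "k' + 1"] by (simp add: algebra_simps)
    have "cq (y (i' + p, k' + q)) mod 4 = cq (x (i', k')) mod 4"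
    proof -
      have "(cq (y (i' + p, k' + q)) + c) mod 4 = (cq (x (i', k')) + c) mod 4"
        if "c = of_bool (cm (x (i', k' + 1)) \<noteq> 1)" for c
        using valid_v[OF x, of i' k'] valid_v[OF y, of "i' + p" "k' + q"] that by (simp add: vrule_def e)
      then show ?thesis by (simp add: mod_eq_dvd_iff)
    qed
    then show ?thesis
      using valid_v[OF x, of i' k'] valid_v[OF y, of "i' + p" "k' + q"] cell_cq_mod[OF valid_cell[OF x]] cell_cq_mod[OF valid_cell[OF y]]
      by (simp add: vrule_def e)
  qed
  have row: "cb (y (i' + p, k' + q)) = cb (x (i', k')) \<and> cp (y (i' + p, k' + q)) = cp (x (i', k'))"
    if k': "(i', k') \<in> ?B \<or> (i' + 1, k') \<in> ?B" for i' k'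
    using k'
  proof
    assume "(i', k') \<in> ?B" then show ?thesis using eq by simp
  next
    assume "(i' + 1, k') \<in> ?B"
    then have e: "y (i' + p + 1, k' + q) = x (i' + 1, k')" using eq[of "i' + 1" "k'"] by (simp add: algebra_simps)
    have "cp (y (i' + p, k' + q)) mod 4 = cp (x (i', k')) mod 4"
    proof -
      have "(cp (y (i' + p, k' + q)) + c) mod 4 = (cp (x (i', k')) + c) mod 4"
        if "c = of_bool (cm (x (i' + 1, k')) \<noteq> -1)" for c
        using valid_h[OF x, of i' k'] valid_h[OF y, of "i' + p" "k' + q"] that by (simp add: hrule_def e)
      then show ?thesis by (simp add: mod_eq_dvd_iff)
    qed
    then show ?thesis
      using valid_h[OF x, of i' k'] valid_h[OF y, of "i' + p" "k' + q"] cell_cp_mod[OF valid_cell[OF x]] cell_cp_mod[OF valid_cell[OF y]]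
      by (simp add: hrule_def e)
  qed
  have in1: "c div 2 \<in> {- (- a div 2)..<- (- a div 2) + N}" if "even c" "c \<in> {a..<a + 2 * N}" for a c
    using that by auto
  have in2: "c div 2 \<in> {- (- a div 2)..<- (- a div 2) + N} \<or> c div 2 + 1 \<in> {- (- a div 2)..<- (- a div 2) + N}"
    if "odd c" "c \<in> {a..<a + 2 * N}" for a c
    using that N by auto
  have i: "i \<in> {a..<a + 2 * N}" "k \<in> {b..<b + 2 * N}" using ik by (auto simp: square_def)
  show ?thesis
  proof (cases "even i"; cases "even k")
    assume e: "even i" "even k"
    then have "(i div 2, k div 2) \<in> ?B" using in1 i by (simp add: square_def)
    then show ?thesis using e eq by (simp add: inflate_def d)
  next
    assume e: "even i" "odd k"
    then have "(i div 2, k div 2) \<in> ?B \<or> (i div 2, k div 2 + 1) \<in> ?B"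
      using in1 in2 i unfolding square_def by blast
    from col[OF this] show ?thesis using e by (simp add: inflate_def d m Let_def)
  next
    assume e: "odd i" "even k"
    then have "(i div 2, k div 2) \<in> ?B \<or> (i div 2 + 1, k div 2) \<in> ?B"
      using in1 in2 i unfolding square_def by blast
    from row[OF this] show ?thesis using e by (simp add: inflate_def d m Let_def)
  next
    assume "odd i" "odd k" then show ?thesis by (simp add: inflate_def m)
  qed
qed

lemma dvd_shift_double:
  fixes p s u N :: int
  assumes "2 * N dvd p - (2 * u - s)"
  obtains p' where "p + s = 2 * (p' + u)" "N dvd p'"
proof -
  obtain r where "p - (2 * u - s) = 2 * N * r"
    using assms by (rule dvdE)
  then have "p + s = 2 * (N * r + u)" by simp
  then show thesis using that by simp
qed

text \<open>By induction the reduced tiling shares a square of half the side with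
  \<open>ystar\<close> along a coset. Inflating both doubles side and period and leaves
  \<open>ystar\<close> fixed; evenness of the offset preserves positions modulo 4 under
  inflation.\<close>

lemma valid_occurs:
  assumes "valid x"
  shows "\<exists>w. even (fst w) \<and> even (snd w) \<and> occurs_at (2 ^ (m + 5)) x (square a b (2 ^ m)) w"
  using assms
proof (induction m arbitrary: x a b)
  case 0
  obtain I K where IK: "even (I - a)" "even (K - b)"
    "\<And>I' K'. 32 dvd I' - I \<Longrightarrow> 32 dvd K' - K \<Longrightarrow> ystar (I', K') = x (a, b)"
    by (rule cell_realised[OF 0]) blast
  have "square a b (2 ^ 0) = {(a, b)}" by (auto simp: square_def)
  moreover have "ystar (a + p, b + q) = x (a, b)" if "32 dvd p - (I - a)" "32 dvd q - (K - b)" for p q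
    using IK(3)[of "a + p" "b + q"] that by (simp add: algebra_simps)
  ultimately have "occurs_at (2 ^ (0 + 5)) x (square a b (2 ^ 0)) (I - a, K - b)"
    by (simp add: occurs_at_def)
  then show ?case using IK(1,2) by (intro exI[of _ "(I - a, K - b)"]) simp
next
  case (Suc m)
  obtain s t where st: "even s" "even t" and y: "normal (\<lambda>(i, k). x (i + s, k + t))" (is "normal ?y")
    using valid_normalise[OF Suc.prems] by metis
  let ?a = "- (- (a - s) div 2)" and ?b = "- (- (b - t) div 2)"
  obtain w where w: "even (fst w)" "even (snd w)" "occurs_at (2 ^ (m + 5)) (deflate ?y) (square ?a ?b (2 ^ m)) w"
    using Suc.IH[OF valid_deflate[OF y]] by blast
  have "occurs_at (2 ^ (Suc m + 5)) x (square a b (2 ^ Suc m)) (2 * fst w - s, 2 * snd w - t)"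
    unfolding occurs_at_def
  proof (intro allI impI, clarify)
    fix p q i k
    assume p: "2 ^ (Suc m + 5) dvd p - fst (2 * fst w - s, 2 * snd w - t)"
      and q: "2 ^ (Suc m + 5) dvd q - snd (2 * fst w - s, 2 * snd w - t)"
      and ik: "(i, k) \<in> square a b (2 ^ Suc m)"
    have N: "(2::int) ^ (Suc m + 5) = 2 * 2 ^ (m + 5)" by (simp only: add_Suc power_Suc)
    obtain p' where p': "p + s = 2 * (p' + fst w)" "2 ^ (m + 5) dvd p'"
      using p unfolding N fst_conv by (rule dvd_shift_double)
    obtain q' where q': "q + t = 2 * (q' + snd w)" "2 ^ (m + 5) dvd q'"
      using q unfolding N snd_conv by (rule dvd_shift_double)
    have "even ((2::int) ^ (m + 5))" by simp
    then have ev: "even (p' + fst w)" "even (q' + snd w)" using p'(2) q'(2) w(1,2) by (auto dest: dvd_trans)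
    have "inflate ystar ((i - s) + 2 * (p' + fst w), (k - t) + 2 * (q' + snd w)) = inflate (deflate ?y) (i - s, k - t)"
    proof (rule inflate_square[OF valid_deflate[OF y] valid_ystar ev, of "2 ^ m"])
      fix i' k' assume "(i', k') \<in> square ?a ?b (2 ^ m)"
      then show "ystar (i' + (p' + fst w), k' + (q' + snd w)) = deflate ?y (i', k')"
        using occurs_atD[OF w(3), of "p' + fst w" "q' + snd w"] p'(2) q'(2) by simp
    next
      show "(i - s, k - t) \<in> square (a - s) (b - t) (2 * 2 ^ m)" using ik by (auto simp: square_def)
    qed simp
    moreover have "(i - s) + 2 * (p' + fst w) = i + p" "(k - t) + 2 * (q' + snd w) = k + q"
      using p'(1) q'(1) by linarith+
    ultimately have "ystar (i + p, k + q) = ?y (i - s, k - t)"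
      by (simp only: inflate_ystar inflate_deflate[OF y])
    then show "ystar (i + p, k + q) = x (i, k)" by simp
  qed
  then show ?case using w(1,2) st by (intro exI[of _ "(2 * fst w - s, 2 * snd w - t)"]) simp
qed

section \<open>Lipschitz coordinates\<close>

text \<open>A function is \<open>lip\<close> iff it grows by 2 to 4 per horizontal step and by at most 1 in absolute value
  per vertical step. Written as a bound by a subadditive function, this admits the McShane extension below.\<close>

definition cone :: "site \<Rightarrow> int" where
  "cone v = max (2 * fst v) (4 * fst v) + \<bar>snd v\<bar>"

definition lip :: "(site \<Rightarrow> int) \<Rightarrow> bool" where
  "lip f \<longleftrightarrow> (\<forall>v w. f w - f v \<le> cone (w - v))"

lemma lipD: "lip f \<Longrightarrow> f w - f v \<le> cone (w - v)"
  unfolding lip_def by blast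

lemma cone_0 [simp]: "cone 0 = 0"
  by (simp add: cone_def)

lemma cone_add: "cone (u + v) \<le> cone u + cone v"
  by (simp add: cone_def)

lemma lip_extend:
  assumes S: "finite S" "S \<noteq> {}"
    and f: "\<And>v w. v \<in> S \<Longrightarrow> w \<in> S \<Longrightarrow> f w - f v \<le> cone (w - v)"
  obtains h where "lip h" "\<And>v. v \<in> S \<Longrightarrow> h v = f v"
proof
  define h where "h w = Min ((\<lambda>v. f v + cone (w - v)) ` S)" for w
  have le: "h w \<le> f v + cone (w - v)" if "v \<in> S" for v w
    unfolding h_def using S(1) that by simp
  have ex: "\<exists>v\<in>S. h w = f v + cone (w - v)" for w
  proof -
    have "h w \<in> (\<lambda>v. f v + cone (w - v)) ` S" unfolding h_def using S by (intro Min_in) auto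
    then show ?thesis by blast
  qed
  show "lip h"
    unfolding lip_def
  proof (intro allI)
    fix v w
    obtain s where s: "s \<in> S" "h v = f s + cone (v - s)" using ex by blast
    have "cone (w - s) \<le> cone (w - v) + cone (v - s)"
      using cone_add[of "w - v" "v - s"] by simp
    then show "h w - h v \<le> cone (w - v)"
      using le[OF s(1), of w] s(2) by linarith
  qed
  show "h v = f v" if v: "v \<in> S" for v
  proof (rule antisym)
    show "h v \<le> f v" using le[OF v, of v] by simp
    obtain s where s: "s \<in> S" "h v = f s + cone (v - s)" using ex by blast
    show "f v \<le> h v" using f[OF s(1) v] s(2) by linarith
  qed
qed

lemma lip_steps:
  assumes "lip f"
  shows "2 \<le> f (a + 1, b) - f (a, b)" "f (a + 1, b) - f (a, b) \<le> 4" "\<bar>f (a, b + 1) - f (a, b)\<bar> \<le> 1"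
  using lipD[OF assms, of "(a + 1, b)" "(a, b)"] lipD[OF assms, of "(a, b)" "(a + 1, b)"]
    lipD[OF assms, of "(a, b + 1)" "(a, b)"] lipD[OF assms, of "(a, b)" "(a, b + 1)"]
  by (simp_all add: cone_def)

lemma int_steps:
  fixes f :: "int \<Rightarrow> int"
  assumes "\<And>k. l \<le> f (k + 1) - f k" "\<And>k. f (k + 1) - f k \<le> u"
  shows "f (k + int n) - f k \<in> {l * int n..u * int n}"
proof (induction n)
  case (Suc n)
  then show ?case using assms[of "k + int n"] by (simp add: algebra_simps)
qed simp

lemma lip_of_steps:
  assumes h: "\<And>a b. f (a + 1, b) - f (a, b) \<in> {2..4}" and v: "\<And>a b. \<bar>f (a, b + 1) - f (a, b)\<bar> \<le> 1"
  shows "lip f"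
  unfolding lip_def
proof (intro allI)
  fix v w :: site
  obtain a b c d where vw: "v = (a, b)" "w = (c, d)" by (cases v, cases w)
  have "f (c, d) - f (a, d) \<le> max (2 * (c - a)) (4 * (c - a))"
    using int_steps[of 2 "\<lambda>k. f (k, d)" 4 a "nat (c - a)"] int_steps[of 2 "\<lambda>k. f (k, d)" 4 c "nat (a - c)"] h
    by (cases "a \<le> c") auto
  moreover have "-1 \<le> f (a, b + 1) - f (a, b)" "f (a, b + 1) - f (a, b) \<le> 1" for a b
    using v[of a b] by linarith+
  then have "f (a, d) - f (a, b) \<le> \<bar>d - b\<bar>"
    using int_steps[of "-1" "\<lambda>k. f (a, k)" 1 b "nat (d - b)"] int_steps[of "-1" "\<lambda>k. f (a, k)" 1 d "nat (b - d)"]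
    by (cases "b \<le> d") auto
  ultimately show "f w - f v \<le> cone (w - v)" by (simp add: vw cone_def)
qed

section \<open>Lifting residues to Lipschitz functions\<close>

lemma antidifference:
  fixes d :: "int \<Rightarrow> int"
  obtains F where "F 0 = 0" "\<And>k. F (k + 1) - F k = d k"
proof -
  let ?F = "\<lambda>k. if 0 \<le> k then (\<Sum>i\<in>{0..<k}. d i) else - (\<Sum>i\<in>{k..<0}. d i)"
  have "?F (k + 1) - ?F k = d k" for k
  proof (cases "0 \<le> k")
    case True
    then have "{0..<k + 1} = insert k {0..<k}" by auto
    then show ?thesis using True by simp
  next
    case False
    then have "{k..<0} = insert k {k + 1..<0}" by auto
    then show ?thesis using False by (cases "k = -1") simp_all
  qed
  then show thesis using that[of ?F] by simp
qed

text \<open>A closed 1-form on the grid is exact: integrate along row 0, then along columns.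
  Closedness carries the prescribed horizontal increment from row 0 to every other row.\<close>

lemma potential:
  fixes d e :: "site \<Rightarrow> int"
  assumes closed: "\<And>a b. d (a, b) + e (a + 1, b) = e (a, b) + d (a, b + 1)"
  obtains F where "\<And>a b. F (a + 1, b) - F (a, b) = d (a, b)" "\<And>a b. F (a, b + 1) - F (a, b) = e (a, b)"
proof -
  obtain G where G: "\<And>a. G (a + 1) - G a = d (a, 0)" using antidifference[of "\<lambda>a. d (a, 0)"] by metis
  have "\<exists>H. H 0 = 0 \<and> (\<forall>b. H (b + 1) - H b = e (a, b))" for a
    using antidifference[of "\<lambda>b. e (a, b)"] by metis
  then obtain H where H: "\<And>a. H a 0 = 0" "\<And>a b. H a (b + 1) - H a b = e (a, b)" by metis
  have "G (a + 1) - G a + H (a + 1) b - H a b - d (a, b) = G (a + 1) - G a + H (a + 1) 0 - H a 0 - d (a, 0)" for a b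
  proof (rule int_const[of "\<lambda>b. G (a + 1) - G a + H (a + 1) b - H a b - d (a, b)"])
    fix b show "G (a + 1) - G a + H (a + 1) (b + 1) - H a (b + 1) - d (a, b + 1) =
      G (a + 1) - G a + H (a + 1) b - H a b - d (a, b)"
      using H(2)[of a b] H(2)[of "a + 1" b] closed[of a b] by linarith
  qed
  then have D: "G (a + 1) - G a + H (a + 1) b - H a b = d (a, b)" for a b
    using G[of a] H(1) by (metis add.right_neutral diff_0_right diff_self eq_iff_diff_eq_0)
  show thesis
    by (rule that[of "\<lambda>(a, b). G a + H a b"]) (use D H(2) in \<open>auto simp: algebra_simps\<close>)
qed

text \<open>The sum of the chosen increments around a unit square is a multiple of \<open>M\<close>
  and at most 4 in absolute value, hence 0; so the increments integrate to a function.\<close>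

lemma lift_residues:
  fixes r :: "site \<Rightarrow> int"
  assumes M: "10 \<le> M"
    and h: "\<And>a b. \<exists>d\<in>{2..4}. M dvd r (a + 1, b) - r (a, b) - d"
    and v: "\<And>a b. \<exists>d\<in>{-1..1}. M dvd r (a, b + 1) - r (a, b) - d"
  obtains f where "lip f" "\<And>v. M dvd f v - r v"
proof -
  obtain d where d: "\<And>a b. d (a, b) \<in> {2..4}" "\<And>a b. M dvd r (a + 1, b) - r (a, b) - d (a, b)"
  proof -
    have "\<forall>v. \<exists>d. d \<in> {2..4} \<and> M dvd r (fst v + 1, snd v) - r v - d" using h by fastforce
    then show thesis using that by (metis fst_conv snd_conv)
  qed
  obtain e where e: "\<And>a b. e (a, b) \<in> {-1..1}" "\<And>a b. M dvd r (a, b + 1) - r (a, b) - e (a, b)"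
  proof -
    have "\<forall>v. \<exists>d. d \<in> {-1..1} \<and> M dvd r (fst v, snd v + 1) - r v - d" using v by fastforce
    then show thesis using that by (metis fst_conv snd_conv)
  qed
  have closed: "d (a, b) + e (a + 1, b) = e (a, b) + d (a, b + 1)" for a b
  proof -
    let ?k = "d (a, b) + e (a + 1, b) - e (a, b) - d (a, b + 1)"
    have "M dvd (r (a, b + 1) - r (a, b) - e (a, b)) + (r (a + 1, b + 1) - r (a, b + 1) - d (a, b + 1))
      - (r (a + 1, b) - r (a, b) - d (a, b)) - (r (a + 1, b + 1) - r (a + 1, b) - e (a + 1, b))"
      by (intro dvd_diff dvd_add d e)
    then have "M dvd ?k" by (simp add: algebra_simps)
    moreover have "\<bar>?k\<bar> < M" using d(1)[of a b] d(1)[of a "b + 1"] e(1)[of a b] e(1)[of "a + 1" b] M by auto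
    ultimately have "?k = 0" using dvd_imp_le_int[of ?k M] by linarith
    then show ?thesis by linarith
  qed
  obtain F where F: "\<And>a b. F (a + 1, b) - F (a, b) = d (a, b)" "\<And>a b. F (a, b + 1) - F (a, b) = e (a, b)"
    using potential[of d e, OF closed] by blast
  define f where "f v = F v - F (0, 0) + r (0, 0)" for v
  have "lip f"
    using d(1) e(1) by (intro lip_of_steps) (auto simp: f_def F abs_le_iff minus_le_iff)
  moreover have "M dvd f v - r v" for v
  proof -
    have 1: "(f (a, b) - r (a, b)) mod M = (f (a, 0) - r (a, 0)) mod M" for a b
    proof (rule int_const[of "\<lambda>b. (f (a, b) - r (a, b)) mod M"])
      fix b
      have "f (a, b + 1) - f (a, b) = e (a, b)" by (simp add: f_def F)
      then show "(f (a, b + 1) - r (a, b + 1)) mod M = (f (a, b) - r (a, b)) mod M"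
        using e(2)[of a b] unfolding mod_eq_dvd_iff by (metis (no_types, opaque_lifting) dvd_diff_commute diff_diff_eq add.commute diff_add_eq diff_diff_eq2 add_diff_eq)
    qed
    have 2: "(f (a, 0) - r (a, 0)) mod M = (f (0, 0) - r (0, 0)) mod M" for a
    proof (rule int_const[of "\<lambda>a. (f (a, 0) - r (a, 0)) mod M"])
      fix a
      have "f (a + 1, 0) - f (a, 0) = d (a, 0)" by (simp add: f_def F)
      then show "(f (a + 1, 0) - r (a + 1, 0)) mod M = (f (a, 0) - r (a, 0)) mod M"
        using d(2)[of a 0] unfolding mod_eq_dvd_iff by (metis (no_types, opaque_lifting) dvd_diff_commute diff_diff_eq add.commute diff_add_eq diff_diff_eq2 add_diff_eq)
    qed
    have "(f v - r v) mod M = (f (0, 0) - r (0, 0)) mod M" using 1 2 by (cases v) metis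
    then show ?thesis by (simp add: f_def dvd_eq_mod_eq_0)
  qed
  ultimately show thesis by (rule that)
qed


section \<open>Expanding pairs of coordinates\<close>

text \<open>Lets \<open>lip\<close> serve for both coordinates: \<open>lip (swapped g)\<close> makes
  \<open>g\<close> grow along the second axis.\<close>

definition swapped :: "(site \<Rightarrow> 'b) \<Rightarrow> site \<Rightarrow> 'b" where
  "swapped f = (\<lambda>(a, b). f (b, a))"

lemma swapped_apply [simp]: "swapped f (a, b) = f (b, a)"
  by (simp add: swapped_def)

lemma swapped_swapped [simp]: "swapped (swapped f) = f"
  by (auto simp: swapped_def)

text \<open>Both \<open>2 * \<bar>c - a\<bar> - \<bar>d - b\<bar>\<close> and its counterpart with
  the axes exchanged are at most \<open>K\<close>, which bounds the larger displacement and so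
  both.\<close>

lemma expansion:
  assumes f: "lip f" and g: "lip (swapped g)"
    and K: "\<bar>f (c, d) - f (a, b)\<bar> \<le> K" "\<bar>g (c, d) - g (a, b)\<bar> \<le> K"
  shows "\<bar>c - a\<bar> \<le> K \<and> \<bar>d - b\<bar> \<le> K"
proof -
  have "2 * \<bar>c - a\<bar> - \<bar>d - b\<bar> \<le> \<bar>f (c, d) - f (a, b)\<bar>"
    using lipD[OF f, of "(c, d)" "(a, b)"] lipD[OF f, of "(a, b)" "(c, d)"]
    by (auto simp: cone_def max_def abs_if split: if_splits)
  moreover have "2 * \<bar>d - b\<bar> - \<bar>c - a\<bar> \<le> \<bar>g (c, d) - g (a, b)\<bar>"
    using lipD[OF g, of "(d, c)" "(b, a)"] lipD[OF g, of "(b, a)" "(d, c)"]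
    by (auto simp: cone_def max_def abs_if split: if_splits)
  ultimately show ?thesis using K by (intro conjI; linarith)
qed

text \<open>If \<open>\<bar>x\<bar> > 2\<close>, one of the two neighbours lowers
  \<open>\<bar>x\<bar>\<close> by at least 2 while \<open>\<bar>y\<bar>\<close> rises by at most 1,
  contradicting minimality.\<close>

lemma descent_step:
  fixes x y :: int
  assumes "\<bar>x\<bar> + \<bar>y\<bar> \<le> \<bar>x'\<bar> + \<bar>y'\<bar>" "\<bar>x\<bar> + \<bar>y\<bar> \<le> \<bar>x''\<bar> + \<bar>y''\<bar>"
    and x: "2 \<le> x' - x" "x' - x \<le> 4" "2 \<le> x - x''" "x - x'' \<le> 4"
    and "\<bar>y' - y\<bar> \<le> 1" "\<bar>y - y''\<bar> \<le> 1"
  shows "\<bar>x\<bar> \<le> 2"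
proof -
  have "\<bar>x\<bar> \<le> \<bar>x'\<bar> + 1" "\<bar>x\<bar> \<le> \<bar>x''\<bar> + 1" using assms by linarith+
  then show ?thesis using x by linarith
qed

text \<open>At a minimiser of the distance to the target \<open>(5 * i + 2, 5 * k + 2)\<close> both deviations are at most 2.\<close>

lemma coarse_surjective:
  assumes f: "lip f" and g: "lip (swapped g)"
  obtains v where "f v div 5 = i" "g v div 5 = k"
proof -
  define m where "m v = nat (\<bar>f v - (5 * i + 2)\<bar> + \<bar>g v - (5 * k + 2)\<bar>)" for v
  obtain v where min: "\<And>w. m v \<le> m w"
    using ex_has_least_nat[of "\<lambda>_. True" undefined m] by blast
  obtain a b where v: "v = (a, b)" by (cases v)
  have min': "\<bar>f (a, b) - (5 * i + 2)\<bar> + \<bar>g (a, b) - (5 * k + 2)\<bar> \<le> \<bar>f w - (5 * i + 2)\<bar> + \<bar>g w - (5 * k + 2)\<bar>" for w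
    using min[of w] by (simp add: m_def v nat_le_eq_zle)
  note sf = lip_steps[OF f] and sg = lip_steps[OF g, unfolded swapped_apply]
  have "\<bar>f v - (5 * i + 2)\<bar> \<le> 2"
    unfolding v
    by (rule descent_step[OF min'[of "(a + 1, b)"] min'[of "(a - 1, b)"]])
      (use sf(1,2)[of a b] sf(1,2)[of "a - 1" b] sg(3)[of a b] sg(3)[of "a - 1" b] in simp_all)
  moreover have "\<bar>g v - (5 * k + 2)\<bar> \<le> 2"
    unfolding v
    by (rule descent_step[OF min'[of "(a, b + 1)", unfolded add.commute[of "\<bar>f _ - _\<bar>"]]
        min'[of "(a, b - 1)", unfolded add.commute[of "\<bar>f _ - _\<bar>"]]])
      (use sg(1,2)[of a b] sg(1,2)[of a "b - 1"] sf(3)[of a b] sf(3)[of a "b - 1"] in simp_all)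
  ultimately have "f v div 5 = i" "g v div 5 = k" by presburger+
  then show thesis by (rule that)
qed

section \<open>Distorted tilings\<close>

type_synonym letter = "int \<times> int \<times> sym"

definition admissible :: "(site \<Rightarrow> int) \<Rightarrow> (site \<Rightarrow> int) \<Rightarrow> sym config \<Rightarrow> bool" where
  "admissible f g x \<longleftrightarrow> lip f \<and> lip (swapped g) \<and> valid x"

text \<open>A letter carries the fine coordinates modulo 110 and the tile at the coarse position
  \<open>(f v div 5, g v div 5)\<close>. The modulus is \<open>5 * 22\<close>: the factor 2 keeps the parity of the coarse position
  visible, 11 is prime to the period of the tiling, and 110 exceeds twice the variation 45 of the coordinates
  over half a window.\<close>

definition coded :: "(site \<Rightarrow> int) \<Rightarrow> (site \<Rightarrow> int) \<Rightarrow> sym config \<Rightarrow> letter config" where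
  "coded f g x = (\<lambda>v. (f v mod 110, g v mod 110, x (f v div 5, g v div 5)))"

text \<open>Coordinates whose coarse values differ by at most 1 differ by at most 9, and by
  \<open>expansion\<close> the same bound holds for the sites.\<close>

definition window :: "site set" where
  "window = {-9..9} \<times> {-9..9}"

definition locally_admissible :: "letter config \<Rightarrow> bool" where
  "locally_admissible z \<longleftrightarrow> (\<exists>f g x. admissible f g x \<and> (\<forall>s\<in>window. z s = coded f g x s))"

lemma lip_shift: "lip f \<Longrightarrow> lip (\<lambda>v. f (u + v))"
  unfolding lip_def by (metis add_diff_cancel_left)

lemma swapped_shift: "swapped (\<lambda>v. g ((a, b) + v)) = (\<lambda>v. swapped g ((b, a) + v))"
  by (auto simp: swapped_def)

lemma admissible_shift:
  assumes "admissible f g x"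
  shows "admissible (\<lambda>v. f (u + v)) (\<lambda>v. g (u + v)) x"
  using assms lip_shift[of f u] lip_shift[of "swapped g" "(snd u, fst u)"] swapped_shift[of g "fst u" "snd u"]
  by (simp add: admissible_def)

lemma locally_admissible_coded:
  assumes "admissible f g x"
  shows "locally_admissible (\<lambda>v. coded f g x (u + v))"
  unfolding locally_admissible_def using admissible_shift[OF assms, of u] by (force simp: coded_def)

text \<open>The differences \<open>f (u + v) - f v\<close> are multiples of 110 that change by at
  most 2 between neighbours, so they are constant; likewise for \<open>g\<close>. As the coarse
  positions cover the plane, the constants yield a period of \<open>x\<close>, hence vanish, and
  \<open>expansion\<close> gives \<open>u = 0\<close>.\<close>

lemma admissible_aperiodic:
  assumes adm: "admissible f g x" and per: "\<And>v. coded f g x (u + v) = coded f g x v"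
  shows "u = 0"
proof -
  have f: "lip f" and g: "lip (swapped g)" and x: "valid x" using adm by (simp_all add: admissible_def)
  have const: "\<exists>t. \<forall>v. f (u + v) = f v + 110 * t" if f: "lip f" and p: "\<And>v. f (u + v) mod 110 = f v mod 110" for f u
  proof -
    have D: "110 dvd f (u + v) - f v" for v using p[of v] by (simp add: mod_eq_dvd_iff)
    have eq: "f (u + v) - f v = f (u + w) - f w"
      if "\<bar>(f (u + v) - f v) - (f (u + w) - f w)\<bar> \<le> 2" for v w
    proof -
      have "110 dvd (f (u + v) - f v) - (f (u + w) - f w)" by (rule dvd_diff[OF D D])
      then show ?thesis using that dvd_imp_le_int[of "(f (u + v) - f v) - (f (u + w) - f w)" 110] by linarith
    qed
    obtain a b where u: "u = (a, b)" by (cases u)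
    have 1: "f (u + (i, k)) - f (i, k) = f (u + (i, 0)) - f (i, 0)" for i k
    proof (rule int_const[of "\<lambda>k. f (u + (i, k)) - f (i, k)"])
      fix k show "f (u + (i, k + 1)) - f (i, k + 1) = f (u + (i, k)) - f (i, k)"
        using lip_steps(3)[OF f, of i k] lip_steps(3)[OF f, of "a + i" "b + k"]
        by (intro eq) (simp add: u algebra_simps)
    qed
    have 2: "f (u + (i, 0)) - f (i, 0) = f (u + (0, 0)) - f (0, 0)" for i
    proof (rule int_const[of "\<lambda>i. f (u + (i, 0)) - f (i, 0)"])
      fix i show "f (u + (i + 1, 0)) - f (i + 1, 0) = f (u + (i, 0)) - f (i, 0)"
        using lip_steps(1,2)[OF f, of i 0] lip_steps(1,2)[OF f, of "a + i" b]
        by (intro eq) (simp add: u algebra_simps)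
    qed
    obtain t where t: "f (u + (0, 0)) - f (0, 0) = 110 * t" using D[of "(0, 0)"] unfolding dvd_def by blast
    have "f (u + v) = f v + 110 * t" for v
      using 1[of "fst v" "snd v"] 2[of "fst v"] t by simp
    then show ?thesis by blast
  qed
  have pf: "f (u + v) mod 110 = f v mod 110" and pg: "g (u + v) mod 110 = g v mod 110"
    and px: "x (f (u + v) div 5, g (u + v) div 5) = x (f v div 5, g v div 5)" for v
    using per[of v] by (simp_all add: coded_def)
  obtain t1 where t1: "\<And>v. f (u + v) = f v + 110 * t1" using const[OF f, of u] pf by blast
  have "swapped g ((snd u, fst u) + v) mod 110 = swapped g v mod 110" for v
    using pg[of "(snd v, fst v)"] by (simp add: swapped_def case_prod_beta plus_prod_def)
  then obtain t2 where t2: "\<And>v. swapped g ((snd u, fst u) + v) = swapped g v + 110 * t2"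
    using const[OF g, of "(snd u, fst u)"] by blast
  have t2: "g (u + v) = g v + 110 * t2" for v
    using t2[of "(snd v, fst v)"] by (simp add: swapped_def case_prod_beta plus_prod_def)
  have "periodic_by x (22 * t1) (22 * t2)"
    unfolding periodic_by_def
  proof (intro allI)
    fix i k
    obtain v where v: "f v div 5 = i" "g v div 5 = k" using coarse_surjective[OF f g] by blast
    have "f (u + v) div 5 = i + 22 * t1" "g (u + v) div 5 = k + 22 * t2"
      unfolding t1 t2 v[symmetric] by simp_all
    then show "x (i + 22 * t1, k + 22 * t2) = x (i, k)" using px[of v] v by simp
  qed
  then have "t1 = 0" "t2 = 0" using valid_aperiodic[OF x] by fastforce+
  then have "f u = f 0" "g u = g 0" using t1[of 0] t2[of 0] by simp_all
  then show ?thesis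
    using expansion[OF f g, of "fst u" "snd u" 0 0 0] by (simp add: zero_prod_def prod_eq_iff)
qed

section \<open>Recovering coordinates and tiling from local rules\<close>

text \<open>Each function stays within \<open>4 * 9 + 9 = 45\<close> of its value at the centre, so
  the difference of the two varies by at most 90 from the centre. Being constant modulo 110, it is
  constant.\<close>

lemma lift_window:
  assumes f: "lip f" and f': "lip f'" and eq: "\<And>s. s \<in> window \<Longrightarrow> 110 dvd f (u + s) - f' s"
  obtains t where "\<And>s. s \<in> window \<Longrightarrow> f (u + s) = f' s + 110 * t"
proof -
  have "0 \<in> window" by (simp add: window_def zero_prod_def)
  then have 0: "110 dvd f u - f' 0" using eq[of 0] by simp
  then obtain t where t: "f u - f' 0 = 110 * t" unfolding dvd_def by blast
  have "f (u + s) = f' s + 110 * t" if s: "s \<in> window" for s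
  proof -
    have "\<bar>f (u + s) - f u\<bar> \<le> 45" "\<bar>f' s - f' 0\<bar> \<le> 45"
      using lipD[OF f, of "u + s" u] lipD[OF f, of u "u + s"] lipD[OF f', of s 0] lipD[OF f', of 0 s] s
      by (auto simp: cone_def window_def)
    then have "\<bar>(f (u + s) - f' s) - (f u - f' 0)\<bar> < 110" by linarith
    moreover have "110 dvd (f (u + s) - f' s) - (f u - f' 0)" using eq[OF s] 0 by (rule dvd_diff)
    ultimately have "(f (u + s) - f' s) - (f u - f' 0) = 0"
      using dvd_imp_le_int[of "(f (u + s) - f' s) - (f u - f' 0)" 110] by linarith
    then show ?thesis using t by linarith
  qed
  then show thesis by (rule that)
qed

lemma valid_local:
  assumes "\<And>i k. \<exists>y. valid y \<and> y (i, k) = x (i, k) \<and> y (i + 1, k) = x (i + 1, k) \<and> y (i, k + 1) = x (i, k + 1)"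
  shows "valid x"
  unfolding valid_def
proof (intro allI)
  fix i k
  obtain y where y: "valid y" "y (i, k) = x (i, k)" "y (i + 1, k) = x (i + 1, k)" "y (i, k + 1) = x (i, k + 1)"
    using assms[of i k] by blast
  show "cell (x (i, k)) \<and> hrule (x (i, k)) (x (i + 1, k)) \<and> vrule (x (i, k)) (x (i, k + 1)) \<and>
      (odd i \<and> odd k \<longrightarrow> cm (x (i, k)) = 0)"
    using valid_cell[OF y(1), of i k] valid_h[OF y(1), of i k] valid_v[OF y(1), of i k] valid_odd[OF y(1), of i k]
    unfolding y(2-4) by blast
qed

lemma dvd_diff_residues: "(M::int) dvd (p mod M - q mod M) - (p - q)"
  unfolding mod_eq_dvd_iff[symmetric] by (rule mod_diff_eq)

text \<open>Neighbouring residues are compared inside one window, whose local function supplies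
  increments suited to \<open>lift_residues\<close>.\<close>

lemma global_lift:
  assumes loc: "\<And>u. lip (f u) \<and> (\<forall>s\<in>window. r (u + s) = f u s mod 110)"
  obtains h where "lip h" "\<And>v. h v mod 110 = r v"
    "\<And>u. \<exists>t. \<forall>s\<in>window. h (u + s) = f u s + 110 * t"
proof -
  have r: "r ((a, b) + s) = f (a, b) s mod 110" if "s \<in> window" for a b s using loc that by blast
  have in_w: "(0, 0) \<in> window" "(1, 0) \<in> window" "(0, 1) \<in> window" by (simp_all add: window_def)
  have d: "110 dvd r (a + 1, b) - r (a, b) - (f (a, b) (1, 0) - f (a, b) (0, 0))"
    "110 dvd r (a, b + 1) - r (a, b) - (f (a, b) (0, 1) - f (a, b) (0, 0))" for a b
    using r[OF in_w(1), of a b] r[OF in_w(2), of a b] r[OF in_w(3), of a b]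
      dvd_diff_residues[of 110 "f (a, b) (1, 0)" "f (a, b) (0, 0)"]
      dvd_diff_residues[of 110 "f (a, b) (0, 1)" "f (a, b) (0, 0)"]
    by simp_all
  have l: "lip (f u)" for u using loc by blast
  have 1: "\<exists>d\<in>{2..4}. 110 dvd r (a + 1, b) - r (a, b) - d" for a b
    using d(1)[of a b] lip_steps(1,2)[OF l, of "(a, b)" 0 0] by (intro bexI) auto
  have 2: "\<exists>d\<in>{-1..1}. 110 dvd r (a, b + 1) - r (a, b) - d" for a b
    using d(2)[of a b] lip_steps(3)[OF l, of "(a, b)" 0 0] by (intro bexI) auto
  obtain h where h: "lip h" "\<And>v. 110 dvd h v - r v"
    using lift_residues[of 110 r] 1 2 by auto
  have "0 \<in> window" using in_w(1) by (simp add: zero_prod_def)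
  then have "r v mod 110 = r v" for v using loc[of v] by fastforce
  then have "h v mod 110 = r v" for v using h(2)[of v] by (metis mod_eq_dvd_iff)
  moreover have "\<exists>t. \<forall>s\<in>window. h (u + s) = f u s + 110 * t" for u
  proof -
    have "110 dvd h (u + s) - f u s" if "s \<in> window" for s
      using h(2)[of "u + s"] loc[of u] that by (metis mod_eq_dvd_iff mod_mod_trivial)
    then show ?thesis using lift_window[OF h(1) l, of u u] by metis
  qed
  ultimately show thesis using that h(1) by blast
qed

lemma diff_le_of_div5:
  fixes a b :: int
  assumes "\<bar>a div 5 - b div 5\<bar> \<le> 1"
  shows "\<bar>a - b\<bar> \<le> 9"
  using assms mult_div_mod_eq[of 5 a] mult_div_mod_eq[of 5 b] pos_mod_bound[of 5 a] pos_mod_bound[of 5 b]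
    pos_mod_sign[of 5 a] pos_mod_sign[of 5 b] by linarith

lemma window_swap: "(a, b) \<in> window \<longleftrightarrow> (b, a) \<in> window"
  by (auto simp: window_def)

text \<open>The coordinates are lifted first. Relative to them each local tiling is displaced by
  multiples of 22, an even amount, so it stays valid. Sites with equal or adjacent coarse positions
  lie in a common window, so tiles can be read at arbitrarily chosen preimages, and validity of the
  result is a local matter.\<close>

lemma locally_admissible_imp_coded:
  assumes "\<And>u. locally_admissible (\<lambda>v. z (u + v))"
  obtains f g x where "admissible f g x" "z = coded f g x"
proof -
  obtain F G Y where loc: "\<And>u. admissible (F u) (G u) (Y u)"
    "\<And>u s. s \<in> window \<Longrightarrow> z (u + s) = coded (F u) (G u) (Y u) s"
    using assms unfolding locally_admissible_def by metis
  obtain f where f: "lip f" "\<And>v. f v mod 110 = fst (z v)"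
    "\<And>u. \<exists>t. \<forall>s\<in>window. f (u + s) = F u s + 110 * t"
    by (rule global_lift[of F "\<lambda>v. fst (z v)"]) (use loc in \<open>auto simp: admissible_def coded_def\<close>)
  define G' where "G' u = swapped (G (snd u, fst u))" for u
  have "swapped (\<lambda>v. fst (snd (z v))) (u + s) = G' u s mod 110" if "s \<in> window" for u s
    using loc(2)[of "(snd s, fst s)" "(snd u, fst u)"] that window_swap[of "fst s" "snd s"]
    by (simp add: G'_def swapped_def case_prod_beta plus_prod_def coded_def)
  moreover have "lip (G' u)" for u using loc(1) by (simp add: G'_def admissible_def)
  ultimately obtain g' where g': "lip g'" "\<And>v. g' v mod 110 = swapped (\<lambda>v. fst (snd (z v))) v"
    "\<And>u. \<exists>t. \<forall>s\<in>window. g' (u + s) = G' u s + 110 * t"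
    using global_lift[of G' "swapped (\<lambda>v. fst (snd (z v)))"] by metis
  define g where "g = swapped g'"
  have g: "lip (swapped g)" "g v mod 110 = fst (snd (z v))" for v
    using g'(1) g'(2)[of "(snd v, fst v)"] by (simp_all add: g_def swapped_def case_prod_beta)
  have g3: "\<exists>t. \<forall>s\<in>window. g (u + s) = G u s + 110 * t" for u
  proof -
    obtain t where t: "\<forall>s\<in>window. g' ((snd u, fst u) + s) = G' (snd u, fst u) s + 110 * t" using g'(3) by blast
    have "g (u + s) = G u s + 110 * t" if "s \<in> window" for s
      using t[rule_format, of "(snd s, fst s)"] that window_swap[of "fst s" "snd s"]
      by (simp add: g_def G'_def swapped_def case_prod_beta plus_prod_def)
    then show ?thesis by blast
  qed
  have local: "\<exists>y. valid y \<and> (\<forall>s\<in>window. z (u + s) = coded f g y (u + s))" for u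
  proof -
    obtain t1 t2 where t: "\<forall>s\<in>window. f (u + s) = F u s + 110 * t1" "\<forall>s\<in>window. g (u + s) = G u s + 110 * t2"
      using f(3) g3 by metis
    let ?y = "\<lambda>(i, k). Y u (i + (- 22 * t1), k + (- 22 * t2))"
    have "valid ?y" using loc(1)[of u] by (intro valid_shift_even) (simp_all add: admissible_def)
    moreover have "z (u + s) = coded f g ?y (u + s)" if s: "s \<in> window" for s
    proof -
      have "(a + 110 * t) div 5 = a div 5 + 22 * t" for a t :: int
        by simp
      then show ?thesis
        using loc(2)[OF s, of u] t s by (simp add: coded_def)
    qed
    ultimately show ?thesis by blast
  qed
  have "\<exists>v. f v div 5 = fst k \<and> g v div 5 = snd k" for k :: site
    by (rule coarse_surjective[OF f(1) g(1)]) blast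
  then obtain V where V: "\<And>k. f (V k) div 5 = fst k" "\<And>k. g (V k) div 5 = snd k"
    by metis
  define x where "x k = snd (snd (z (V k)))" for k
  have near: "V k' - v \<in> window"
    if "\<bar>fst k' - f v div 5\<bar> \<le> 1" "\<bar>snd k' - g v div 5\<bar> \<le> 1" for k' v
  proof -
    have "\<bar>f (V k') - f v\<bar> \<le> 9" "\<bar>g (V k') - g v\<bar> \<le> 9"
      using that by (auto intro!: diff_le_of_div5 simp only: V)
    then show ?thesis
      using expansion[OF f(1) g(1), of "fst (V k')" "snd (V k')" "fst v" "snd v" 9]
      by (auto simp: window_def mem_Times_iff)
  qed
  have x_local: "x k = y k"
    if y: "\<forall>s\<in>window. z (u + s) = coded f g y (u + s)"
    and k: "\<bar>fst k - f u div 5\<bar> \<le> 1" "\<bar>snd k - g u div 5\<bar> \<le> 1" for y u k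
  proof -
    have "z (V k) = coded f g y (V k)" using y[rule_format, OF near[OF k]] by simp
    then show ?thesis using V[of k] by (simp add: x_def coded_def)
  qed
  have "valid x"
  proof (rule valid_local)
    fix i k
    obtain y where y: "valid y" "\<forall>s\<in>window. z (V (i, k) + s) = coded f g y (V (i, k) + s)" using local by blast
    show "\<exists>y. valid y \<and> y (i, k) = x (i, k) \<and> y (i + 1, k) = x (i + 1, k) \<and> y (i, k + 1) = x (i, k + 1)"
      using y(1) x_local[OF y(2)] V[of "(i, k)"] by (intro exI[of _ y]) simp
  qed
  then have "admissible f g x" using f(1) g(1) by (simp add: admissible_def)
  moreover have "z = coded f g x"
  proof (rule ext)
    fix v
    obtain y where y: "\<forall>s\<in>window. z (v + s) = coded f g y (v + s)" using local by blast
    have "0 \<in> window" by (simp add: window_def zero_prod_def)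
    then have "z v = coded f g y v" using y by fastforce
    moreover have "x (f v div 5, g v div 5) = y (f v div 5, g v div 5)" using x_local[OF y] by simp
    ultimately show "z v = coded f g x v" by (simp add: coded_def)
  qed
  ultimately show thesis by (rule that)
qed

section \<open>Gluing two blocks\<close>

text \<open>Within a block a coordinate varies by at most \<open>5 * n\<close>; three such errors give the margin \<open>15 * n\<close>.\<close>

lemma lip_glue:
  assumes f: "lip f" and f': "lip f'"
    and c: "f 0 - f' 0 - cone (- u) + 15 * int n \<le> c" "c \<le> f 0 - f' 0 + cone u - 15 * int n"
    and disj: "\<And>s. s \<in> block_support n \<Longrightarrow> u + s \<notin> block_support n" and n: "0 < n"
  obtains h where "lip h" "\<And>s. s \<in> block_support n \<Longrightarrow> h s = f s \<and> h (u + s) = f' s + c"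
proof -
  let ?B = "block_support n"
  define S where "S = ?B \<union> (+) u ` ?B"
  define F where "F v = (if v \<in> ?B then f v else f' (v - u) + c)" for v
  have B: "finite ?B" "?B \<noteq> {}" using n by (auto simp: block_support_def)
  have cross: "f' w + c - f v \<le> cone (u + w - v)" "f v - (f' w + c) \<le> cone (v - (u + w))"
    if v: "v \<in> ?B" and w: "w \<in> ?B" for v w
  proof -
    have small: "cone (v - w) \<le> 5 * int n" "cone (w - v) \<le> 5 * int n" "cone w \<le> 5 * int n" "cone (- v) \<le> 5 * int n"
      "cone v \<le> 5 * int n" "cone (- w) \<le> 5 * int n"
      using v w by (auto simp: block_support_def cone_def)
    have "cone u \<le> cone (u + w - v) + cone (v - w)" "cone (- u) \<le> cone (v - (u + w)) + cone (w - v)"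
      using cone_add[of "u + w - v" "v - w"] cone_add[of "v - (u + w)" "w - v"] by simp_all
    moreover have "f' w - f' 0 \<le> cone w" "f 0 - f v \<le> cone (- v)" "f v - f 0 \<le> cone v" "f' 0 - f' w \<le> cone (- w)"
      using lipD[OF f', of w 0] lipD[OF f, of 0 v] lipD[OF f, of v 0] lipD[OF f', of 0 w] by simp_all
    ultimately show "f' w + c - f v \<le> cone (u + w - v)" "f v - (f' w + c) \<le> cone (v - (u + w))"
      using small c by linarith+
  qed
  have FB: "F s = f s" "F (u + s) = f' s + c" if "s \<in> ?B" for s
    using that disj[OF that] by (simp_all add: F_def)
  have "F w - F v \<le> cone (w - v)" if vw: "v \<in> S" "w \<in> S" for v w
  proof -
    consider "v \<in> ?B" "w \<in> ?B" | s where "v \<in> ?B" "w = u + s" "s \<in> ?B" | s where "v = u + s" "s \<in> ?B" "w \<in> ?B"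
      | s t where "v = u + s" "s \<in> ?B" "w = u + t" "t \<in> ?B"
      using vw unfolding S_def by blast
    then show ?thesis
    proof cases
      case 1 then show ?thesis using lipD[OF f] FB(1) by simp
    next
      case 2 then show ?thesis using cross(1) FB by simp
    next
      case 3 then show ?thesis using cross(2) FB by simp
    next
      case 4 then show ?thesis using lipD[OF f', of t s] FB(2) by simp
    qed
  qed
  moreover have "finite S" "S \<noteq> {}" using B by (simp_all add: S_def)
  ultimately obtain h where h: "lip h" "\<And>v. v \<in> S \<Longrightarrow> h v = F v"
    using lip_extend[of S F] by metis
  show thesis
  proof (rule that[OF h(1)])
    fix s assume s: "s \<in> ?B"
    then show "h s = f s \<and> h (u + s) = f' s + c"
      using h(2)[of s] h(2)[of "u + s"] disj[OF s] by (simp add: S_def F_def)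
  qed
qed

text \<open>As 11 is invertible modulo \<open>2 ^ m\<close> and \<open>w\<close> is even, the two
  congruences have a common solution. Moving it by multiples of \<open>22 * 2 ^ m\<close> changes
  \<open>5 * q\<close> in steps of \<open>110 * 2 ^ m\<close>, so every interval of that length is
  met.\<close>

lemma offset_exists:
  fixes lo w :: int
  assumes w: "even w" and P: "0 < m"
  obtains q where "2 ^ m dvd q - w" "22 dvd q" "lo \<le> 5 * q" "5 * q < lo + 110 * 2 ^ m"
proof -
  obtain e where e: "w = 2 * e" using w by (elim evenE)
  have "gcd (11::int) (2 ^ m) = 1" by simp
  then obtain a b where ab: "a * 11 + b * 2 ^ m = (1::int)" using bezout_int[of 11 "2 ^ m"] by metis
  define q0 where "q0 = 22 * (e * a)"
  have "q0 - w = 2 * e * (a * 11 - 1)" by (simp add: q0_def e algebra_simps)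
  also have "a * 11 - 1 = - b * 2 ^ m" using ab by linarith
  finally have d: "2 ^ m dvd q0 - w" by simp
  define c where "c = lo + (5 * q0 - lo) mod (110 * 2 ^ m)"
  have "110 * 2 ^ m dvd 5 * q0 - c"
    by (simp add: c_def) (metis dvd_minus_mod diff_diff_eq)
  then obtain j where j: "5 * q0 - c = 110 * 2 ^ m * j" by (elim dvdE)
  define q where "q = q0 - 22 * 2 ^ m * j"
  have qc: "5 * q = c" using j by (simp add: q_def)
  have "2 ^ m dvd (q0 - w) - 22 * 2 ^ m * j" using d by (rule dvd_diff) simp
  then have "2 ^ m dvd q - w" by (simp add: q_def algebra_simps)
  moreover have "22 dvd q" by (simp add: q_def q0_def)
  moreover have "(5 * q0 - lo) mod (110 * 2 ^ m) \<in> {0..<110 * 2 ^ m}" by simp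
  then have "lo \<le> 5 * q" "5 * q < lo + 110 * 2 ^ m" unfolding qc c_def by simp_all
  ultimately show thesis using that by blast
qed

lemma power_of_two_between:
  assumes "0 < (n::nat)"
  obtains m where "n \<le> 2 ^ m" "2 ^ m < 2 * n"
proof -
  define m where "m = (LEAST m. n \<le> 2 ^ m)"
  have "n \<le> 2 ^ n" by simp
  then have 1: "n \<le> 2 ^ m" unfolding m_def by (rule LeastI)
  have "2 ^ m < 2 * n"
  proof (cases m)
    case 0 then show ?thesis using assms by simp
  next
    case (Suc k)
    then have "\<not> n \<le> 2 ^ k" using not_less_Least[of k "\<lambda>m. n \<le> 2 ^ m"] by (simp add: m_def)
    then show ?thesis using Suc by simp
  qed
  with 1 show thesis by (rule that)
qed

text \<open>Away from the corner, \<open>f\<close> rises by at most 4 per horizontal and 1 per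
  vertical step and falls only along vertical ones, so it stays between \<open>f 0 - n\<close> and
  \<open>f 0 + 5 * n\<close>.\<close>

lemma lip_block:
  assumes "lip f" "s \<in> block_support n"
  shows "f s div 5 \<in> {(f 0 - int n) div 5..<(f 0 - int n) div 5 + 3 * int n}"
proof -
  have "f 0 - int n \<le> f s" "f s \<le> f 0 + 5 * int n" "0 < int n"
    using assms(2) lipD[OF assms(1), of s 0] lipD[OF assms(1), of 0 s]
    by (auto simp: block_support_def cone_def)
  then show ?thesis by auto
qed

lemma swapped_block: "(a, b) \<in> block_support n \<longleftrightarrow> (b, a) \<in> block_support n"
  by (auto simp: block_support_def)

text \<open>A shifted \<open>ystar\<close> serves as the common tiling. The coarse offsets
  \<open>q1\<close> and \<open>q2\<close> carry the coset of occurrences of the first square to that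
  of the second; being multiples of 22, they preserve the residues modulo 110. The distance of the
  blocks leaves room for such offsets in the Lipschitz extension.\<close>

lemma coded_glue:
  assumes z: "admissible f g x" and z': "admissible f' g' x'" and n: "0 < n"
    and u: "12000 * int n \<le> sup_norm u"
  obtains f'' g'' x'' where "admissible f'' g'' x''"
    "\<And>s. s \<in> block_support n \<Longrightarrow> coded f'' g'' x'' s = coded f g x s"
    "\<And>s. s \<in> block_support n \<Longrightarrow> coded f'' g'' x'' (u + s) = coded f' g' x' s"
proof -
  obtain m where m: "3 * n \<le> 2 ^ m" "2 ^ m < 2 * (3 * n)" using power_of_two_between[of "3 * n"] n by auto
  have m1: "3 * int n \<le> 2 ^ m"
  proof -
    have "int (3 * n) \<le> int (2 ^ m)" using m(1) by (simp only: of_nat_le_iff)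
    then show ?thesis by simp
  qed
  have m2: "2 ^ m < 6 * int n"
  proof -
    have "int (2 ^ m) < int (2 * (3 * n))" using m(2) by (simp only: of_nat_less_iff)
    then show ?thesis by simp
  qed
  have f: "lip f" "lip f'" and g: "lip (swapped g)" "lip (swapped g')" and x: "valid x" "valid x'"
    using z z' by (simp_all add: admissible_def)
  let ?Q = "\<lambda>f g. square ((f 0 - int n) div 5) ((g 0 - int n) div 5) (2 ^ m)"
  have inQ: "(f s div 5, g s div 5) \<in> ?Q f g" if "lip f" "lip (swapped g)" "s \<in> block_support n" for f g s
    using lip_block[OF that(1,3)] lip_block[OF that(2), of "(snd s, fst s)" n] that(3) m1
      swapped_block[of "fst s" "snd s" n]
    by (auto simp: square_def swapped_def case_prod_beta zero_prod_def)
  obtain w where w: "even (fst w)" "even (snd w)" "occurs_at (2 ^ (m + 5)) x (?Q f g) w"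
    using valid_occurs[OF x(1)] by blast
  obtain w' where w': "even (fst w')" "even (snd w')" "occurs_at (2 ^ (m + 5)) x' (?Q f' g') w'"
    using valid_occurs[OF x(2)] by blast
  \<comment> \<open>Origin of the constant 12000: as \<open>2 ^ m < 6 * n\<close>, the left side is
    below \<open>(3520 * 6 + 30) * n = 21150 * n\<close>, while the right side is at least
    \<open>2 * 12000 * n\<close>.\<close>
  have len: "110 * 2 ^ (m + 5) + 30 * int n \<le> cone v + cone (- v)" if "sup_norm v = sup_norm u" for v
  proof -
    have "cone v + cone (- v) = 2 * \<bar>fst v\<bar> + 2 * \<bar>snd v\<bar>" by (simp add: cone_def max_def abs_if)
    moreover have "sup_norm v \<le> \<bar>fst v\<bar> + \<bar>snd v\<bar>" by (simp add: sup_norm_def)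
    moreover have "110 * 2 ^ (m + 5) = 3520 * (2 ^ m :: int)" by (simp add: power_add)
    ultimately show ?thesis using u m2 n that by linarith
  qed
  obtain q1 where q1: "2 ^ (m + 5) dvd q1 - (fst w' - fst w)" "22 dvd q1"
    "f 0 - f' 0 - cone (- u) + 15 * int n \<le> 5 * q1" "5 * q1 < f 0 - f' 0 - cone (- u) + 15 * int n + 110 * 2 ^ (m + 5)"
    using offset_exists[of "fst w' - fst w" "m + 5"] w(1) w'(1) by auto
  define u2 where "u2 = (snd u, fst u)"
  obtain q2 where q2: "2 ^ (m + 5) dvd q2 - (snd w' - snd w)" "22 dvd q2"
    "g 0 - g' 0 - cone (- u2) + 15 * int n \<le> 5 * q2" "5 * q2 < g 0 - g' 0 - cone (- u2) + 15 * int n + 110 * 2 ^ (m + 5)"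
    using offset_exists[of "snd w' - snd w" "m + 5"] w(2) w'(2) by auto
  have disj: "v + s \<notin> block_support n" if "s \<in> block_support n" "sup_norm v = sup_norm u" for v s
  proof (cases v, cases s)
    fix a b c d assume "v = (a, b)" "s = (c, d)"
    then show ?thesis using that u n by (auto simp: block_support_def sup_norm_def max_def split: if_splits)
  qed
  have su: "sup_norm u2 = sup_norm u" by (simp add: u2_def sup_norm_def max.commute)
  have g0: "swapped g 0 = g 0" "swapped g' 0 = g' 0" by (simp_all add: zero_prod_def)
  obtain f'' where f'': "lip f''" "\<And>s. s \<in> block_support n \<Longrightarrow> f'' s = f s \<and> f'' (u + s) = f' s + 5 * q1"
    by (rule lip_glue[OF f, of u n "5 * q1"]) (use q1(3,4) len[of u] disj[of _ u] n in auto)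
  obtain h where h: "lip h"
    "\<And>s. s \<in> block_support n \<Longrightarrow> h s = swapped g s \<and> h (u2 + s) = swapped g' s + 5 * q2"
    by (rule lip_glue[OF g, of u2 n "5 * q2"]) (use q2(3,4) len[OF su] disj[OF _ su] n in \<open>auto simp: g0\<close>)
  define g'' where "g'' = swapped h"
  have g'': "g'' s = g s \<and> g'' (u + s) = g' s + 5 * q2" if "s \<in> block_support n" for s
    using h(2)[of "(snd s, fst s)"] that swapped_block[of "fst s" "snd s" n]
    by (simp add: g''_def u2_def swapped_def case_prod_beta plus_prod_def)
  define x'' where "x'' = (\<lambda>(i, k). ystar (i + fst w, k + snd w))"
  have adm: "admissible f'' g'' x''"
    using f''(1) h(1) valid_shift_even[OF valid_ystar w(1,2)] by (simp add: admissible_def g''_def x''_def)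
  moreover have "coded f'' g'' x'' s = coded f g x s" if s: "s \<in> block_support n" for s
    using f''(2)[OF s] g''[OF s] occurs_atD[OF w(3), of "fst w" "snd w", OF _ _ inQ[OF f(1) g(1) s]]
    by (simp add: coded_def x''_def)
  moreover have "coded f'' g'' x'' (u + s) = coded f' g' x' s" if s: "s \<in> block_support n" for s
  proof -
    have "2 ^ (m + 5) dvd (q1 + fst w) - fst w'" "2 ^ (m + 5) dvd (q2 + snd w) - snd w'"
      using q1(1) q2(1) by (simp_all add: diff_diff_eq2)
    from occurs_atD[OF w'(3) this inQ[OF f(2) g(2) s]]
    have y: "ystar (f' s div 5 + q1 + fst w, g' s div 5 + q2 + snd w) = x' (f' s div 5, g' s div 5)"
      by (simp only: add.assoc)
    have d: "(a + 5 * q) div 5 = a div 5 + q" for a q :: int by simp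
    have r: "(a + 5 * q) mod 110 = a mod 110" if q: "22 dvd q" for a q :: int
    proof -
      obtain k where "q = 22 * k" using q by (rule dvdE)
      then have "a + 5 * q = a + 110 * k" by simp
      then show ?thesis by (simp only: mod_mult_self2)
    qed
    have "f'' (u + s) = f' s + 5 * q1" "g'' (u + s) = g' s + 5 * q2" using f''(2)[OF s] g''[OF s] by blast+
    then show ?thesis
      by (simp only: coded_def x''_def case_prod_conv d r[OF q1(2)] r[OF q2(2)] y)
  qed
  ultimately show thesis by (rule that)
qed

section \<open>The subshift\<close>

text \<open>A condition that depends only on the finite set \<open>S\<close> is imposed by
  forbidding the finitely many patterns on \<open>S\<close> that violate it.\<close>

lemma finite_type_local:
  assumes A: "finite A" and S: "finite S"
    and loc: "\<And>z z'. (\<And>s. s \<in> S \<Longrightarrow> z s = z' s) \<Longrightarrow> P z \<Longrightarrow> P z'"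
  shows "finite_type A {z \<in> UNIV \<rightarrow>\<^sub>E A. \<forall>u. P (shift u z)}"
  unfolding finite_type_def
proof (intro exI conjI)
  let ?F = "Pair S ` {p \<in> S \<rightarrow>\<^sub>E A. \<not> P p}"
  show "finite ?F" using finite_PiE[OF S, of "\<lambda>_. A"] A by simp
  show "\<forall>(S, p)\<in>?F. finite S \<and> p \<in> S \<rightarrow>\<^sub>E A" using S by auto
  have P: "P (restrict z S) \<longleftrightarrow> P z" for z
    using loc[of z "restrict z S"] loc[of "restrict z S" z] by auto
  have "(\<forall>(S, p)\<in>?F. \<forall>u. \<not> occurs S p u z) \<longleftrightarrow> (\<forall>u. P (shift u z))" if z: "z \<in> UNIV \<rightarrow>\<^sub>E A" for z
  proof -
    have "restrict (shift u z) S \<in> S \<rightarrow>\<^sub>E A" for u using z by (auto simp: shift_def)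
    then have "(\<forall>(S, p)\<in>?F. \<forall>u. \<not> occurs S p u z) \<longleftrightarrow> (\<forall>u. P (restrict (shift u z) S))"
      unfolding occurs_def by blast
    then show ?thesis by (simp only: P)
  qed
  then show "{z \<in> UNIV \<rightarrow>\<^sub>E A. \<forall>u. P (shift u z)} =
      {z \<in> UNIV \<rightarrow>\<^sub>E A. \<forall>(S, p)\<in>?F. \<forall>u. \<not> occurs S p u z}" by blast
qed

lemma shift_shift [simp]: "shift u (shift v x) = shift (v + u) x"
  by (simp add: shift_def add.assoc)

text \<open>The full shift is compact by Tychonoff. A violation of \<open>P\<close> at
  \<open>u\<close> is witnessed on the finite set \<open>u + S\<close>, so a whole cylinder avoids
  \<open>X\<close> and \<open>X\<close> is closed.\<close>

lemma subshift_local: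
  assumes A: "finite A" and S: "finite S"
    and loc: "\<And>z z'. (\<And>s. s \<in> S \<Longrightarrow> z s = z' s) \<Longrightarrow> P z \<Longrightarrow> P z'"
    and X: "X = {z \<in> UNIV \<rightarrow>\<^sub>E A. \<forall>u. P (shift u z)}" and ne: "X \<noteq> {}"
  shows "subshift A X"
  unfolding subshift_def
proof (intro conjI allI)
  show "shift u ` X \<subseteq> X" for u
  proof (rule image_subsetI)
    fix z assume "z \<in> X"
    then have "z \<in> UNIV \<rightarrow>\<^sub>E A" and P: "P (shift w z)" for w unfolding X by blast+
    then have "shift u z \<in> UNIV \<rightarrow>\<^sub>E A" by (auto simp: shift_def)
    moreover have "P (shift w (shift u z))" for w using P by simp
    ultimately show "shift u z \<in> X" unfolding X by blast
  qed
  let ?T = "full_shift_topology A"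
  have T: "topspace ?T = UNIV \<rightarrow>\<^sub>E A" by (simp add: full_shift_topology_def)
  have compact: "compact_space ?T"
    unfolding full_shift_topology_def using A by (simp add: compact_space_product_topology compact_space_discrete_topology)
  have "openin ?T (topspace ?T - X)"
  proof (subst openin_subopen, intro ballI)
    fix z assume z: "z \<in> topspace ?T - X"
    then obtain u where u: "\<not> P (shift u z)" by (auto simp: T X)
    let ?U = "\<Pi>\<^sub>E v\<in>UNIV. if v \<in> (+) u ` S then {z v} else A"
    have sub: "(if v \<in> (+) u ` S then {z v} else A) \<subseteq> A" for v using z by (auto simp: T)
    have "openin ?T ?U"
      unfolding full_shift_topology_def
    proof (rule product_topology_basis)
      show "openin (discrete_topology A) (if v \<in> (+) u ` S then {z v} else A)" for v using sub by simp
      have "{v. (if v \<in> (+) u ` S then {z v} else A) \<noteq> topspace (discrete_topology A)} \<subseteq> (+) u ` S" by auto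
      then show "finite {v. (if v \<in> (+) u ` S then {z v} else A) \<noteq> topspace (discrete_topology A)}"
        by (rule finite_subset) (use S in simp)
    qed
    moreover have "z \<in> ?U" using z by (auto simp: T PiE_UNIV_domain)
    moreover have "?U \<subseteq> topspace ?T - X"
    proof
      fix y assume y: "y \<in> ?U"
      then have "y \<in> topspace ?T" unfolding T using sub by (blast intro: PiE_mono[THEN subsetD])
      moreover have "y (u + s) = z (u + s)" if "s \<in> S" for s
        using PiE_mem[OF y UNIV_I, of "u + s"] that by simp
      then have "P (shift u y) \<Longrightarrow> P (shift u z)" using loc[of "shift u y" "shift u z"] by (simp add: shift_def)
      then have "y \<notin> X" using u unfolding X by blast
      ultimately show "y \<in> topspace ?T - X" by blast
    qed
    ultimately show "\<exists>U. openin ?T U \<and> z \<in> U \<and> U \<subseteq> topspace ?T - X" by blast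
  qed
  then have "closedin ?T X" by (auto simp: closedin_def X T)
  then show "compactin ?T X" by (rule closedin_compact_space[OF compact])
qed (use A ne in auto)

section \<open>Transfer to an alphabet of natural numbers\<close>

instance sym :: countable
  by countable_datatype

definition letters :: "letter set" where
  "letters = {0..<110} \<times> {0..<110} \<times> Collect cell"

definition alphabet :: "nat set" where
  "alphabet = to_nat ` letters"

definition the_shift :: "nat config set" where
  "the_shift = {z \<in> UNIV \<rightarrow>\<^sub>E alphabet. \<forall>u. locally_admissible (from_nat \<circ> shift u z)}"

lemma finite_alphabet: "finite alphabet"
proof -
  have "Collect cell \<subseteq> (\<lambda>(a, b, c, d, e). Sym a b c d e) ` ({-1, 0, 1} \<times> {1, 3} \<times> {1, 3} \<times> {0, 1, 2, 3} \<times> {0, 1, 2, 3})"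
  proof
    fix s assume "s \<in> Collect cell"
    then have "cell s" by simp
    then show "s \<in> (\<lambda>(a, b, c, d, e). Sym a b c d e) ` ({-1, 0, 1} \<times> {1, 3} \<times> {1, 3} \<times> {0, 1, 2, 3} \<times> {0, 1, 2, 3})"
      unfolding cell_def by (intro image_eqI[of _ _ "(cm s, ca s, cb s, cp s, cq s)"]) (simp, blast)
  qed
  then have "finite (Collect cell)" by (rule finite_subset) simp
  then show ?thesis by (simp add: alphabet_def letters_def)
qed

lemma locally_admissible_cong:
  assumes "\<And>s. s \<in> window \<Longrightarrow> z s = z' s" "locally_admissible (from_nat \<circ> z)"
  shows "locally_admissible (from_nat \<circ> z')"
  using assms unfolding locally_admissible_def by fastforce

lemma coded_in_the_shift:
  assumes "admissible f g x"
  shows "to_nat \<circ> coded f g x \<in> the_shift"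
proof -
  have "coded f g x v \<in> letters" for v
    using assms valid_cell[of x] by (cases "(f v div 5, g v div 5)") (auto simp: coded_def letters_def admissible_def)
  moreover have "locally_admissible (from_nat \<circ> shift u (to_nat \<circ> coded f g x))" for u
    using locally_admissible_coded[OF assms, of u] by (simp add: shift_def comp_def)
  ultimately show ?thesis by (auto simp: the_shift_def alphabet_def)
qed

lemma the_shift_coded:
  assumes "z \<in> the_shift"
  obtains f g x where "admissible f g x" "z = to_nat \<circ> coded f g x"
proof -
  have z: "z v \<in> alphabet" and loc: "locally_admissible (\<lambda>v. (from_nat \<circ> z) (u + v))" for u v
  proof -
    have "z \<in> UNIV \<rightarrow>\<^sub>E alphabet" "locally_admissible (from_nat \<circ> shift u z)"
      using assms unfolding the_shift_def by blast+
    then show "z v \<in> alphabet" "locally_admissible (\<lambda>v. (from_nat \<circ> z) (u + v))"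
      by (auto simp: shift_def comp_def)
  qed
  obtain f g x where fgx: "admissible f g x" "from_nat \<circ> z = coded f g x"
    using locally_admissible_imp_coded[OF loc] by blast
  have "z = to_nat \<circ> coded f g x"
  proof (rule ext)
    fix v
    obtain l where "z v = to_nat (l :: letter)" using z[of v] by (auto simp: alphabet_def)
    then show "z v = (to_nat \<circ> coded f g x) v" using fun_cong[OF fgx(2), of v] by simp
  qed
  with fgx(1) show thesis by (rule that)
qed

lemma the_shift_nonempty: "the_shift \<noteq> {}"
proof -
  have "lip (\<lambda>(a, b). 2 * a)" by (rule lip_of_steps) simp_all
  moreover have "swapped (\<lambda>(a, b). 2 * b) = (\<lambda>(a, b). 2 * a :: int)" by (auto simp: swapped_def)
  ultimately have "admissible (\<lambda>(a, b). 2 * a) (\<lambda>(a, b). 2 * b) ystar"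
    by (simp add: admissible_def valid_ystar)
  then show ?thesis using coded_in_the_shift by blast
qed

lemma subshift_the_shift: "subshift alphabet the_shift"
  by (rule subshift_local[where S = window and P = "\<lambda>z. locally_admissible (from_nat \<circ> z)"])
    (use finite_alphabet the_shift_nonempty locally_admissible_cong in \<open>auto simp: the_shift_def window_def\<close>)

lemma finite_type_the_shift: "finite_type alphabet the_shift"
  unfolding the_shift_def
  by (rule finite_type_local[where S = window and P = "\<lambda>z. locally_admissible (from_nat \<circ> z)"])
    (use finite_alphabet locally_admissible_cong in \<open>auto simp: window_def\<close>)

lemma aperiodic_the_shift: "aperiodic the_shift"
  unfolding aperiodic_def
proof (intro ballI allI impI notI)
  fix z :: "nat config" and u :: site
  assume z: "z \<in> the_shift" and u: "u \<noteq> (0, 0)" and p: "shift u z = z"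
  obtain f g x where fgx: "admissible f g x" "z = to_nat \<circ> coded f g x" using the_shift_coded[OF z] by blast
  have "coded f g x (u + v) = coded f g x v" for v
    using fun_cong[OF p, of v] by (simp add: fgx(2) shift_def)
  then have "u = 0" by (rule admissible_aperiodic[OF fgx(1)])
  then show False using u by (simp add: zero_prod_def)
qed

lemma block_language_coded:
  assumes "p \<in> block_language the_shift n"
  obtains f g x where "admissible f g x" "p = restrict (to_nat \<circ> coded f g x) (block_support n)"
proof -
  obtain z u where z: "z \<in> the_shift" and p: "p = restrict (shift u z) (block_support n)"
    using assms by (auto simp: block_language_def occurs_def)
  have "shift u z \<in> the_shift" using subshift_the_shift z unfolding subshift_def by blast
  then obtain f g x where "admissible f g x" "shift u z = to_nat \<circ> coded f g x" by (rule the_shift_coded)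
  then show thesis using that p by simp
qed

lemma block_gluing_the_shift: "block_gluing (\<lambda>n. 12000 * n) the_shift"
  unfolding block_gluing_def
proof (intro allI ballI impI)
  fix n p q u
  assume p: "p \<in> block_language the_shift n" and q: "q \<in> block_language the_shift n"
    and u: "int (n + 12000 * n) \<le> sup_norm u"
  obtain f g x where fgx: "admissible f g x" "q = restrict (to_nat \<circ> coded f g x) (block_support n)"
    using block_language_coded[OF q] by blast
  obtain f' g' x' where fgx': "admissible f' g' x'" "p = restrict (to_nat \<circ> coded f' g' x') (block_support n)"
    using block_language_coded[OF p] by blast
  have "\<exists>f'' g'' x''. admissible f'' g'' x'' \<and>
    (\<forall>s\<in>block_support n. coded f'' g'' x'' s = coded f g x s \<and> coded f'' g'' x'' (u + s) = coded f' g' x' s)"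
  proof (cases "n = 0")
    \<comment> \<open>An empty block imposes no condition, so any admissible configuration
      serves.\<close>
    case True
    then show ?thesis using fgx(1) by (auto simp: block_support_def)
  next
    case False
    then have "0 < n" "12000 * int n \<le> sup_norm u" using u by simp_all
    then show ?thesis by (rule coded_glue[OF fgx(1) fgx'(1)]) blast
  qed
  then obtain f'' g'' x'' where adm: "admissible f'' g'' x''"
    and eq: "\<And>s. s \<in> block_support n \<Longrightarrow> coded f'' g'' x'' s = coded f g x s"
      "\<And>s. s \<in> block_support n \<Longrightarrow> coded f'' g'' x'' (u + s) = coded f' g' x' s" by blast
  let ?z = "to_nat \<circ> coded f'' g'' x''"
  have "occurs (block_support n) q (0, 0) ?z"
    using eq(1) unfolding occurs_def fgx(2) by (intro restrict_ext) (simp add: shift_def flip: zero_prod_def)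
  moreover have "occurs (block_support n) p u ?z"
    using eq(2) unfolding occurs_def fgx'(2) by (intro restrict_ext) (simp add: shift_def)
  ultimately show "u \<in> gluing_set the_shift n p q"
    using coded_in_the_shift[OF adm] unfolding gluing_set_def by blast
qed

theorem theorem26:
  shows "\<exists>(A :: nat set) X.
    subshift A X \<and> finite_type A X \<and> aperiodic X \<and> linearly_block_gluing X"
proof (intro exI conjI)
  show "linearly_block_gluing the_shift"
    unfolding linearly_block_gluing_def
    by (intro exI[of _ "\<lambda>n. 12000 * n"] conjI block_gluing_the_shift exI[of _ "12000::real"])
      (auto simp: mono_def)
qed (fact subshift_the_shift finite_type_the_shift aperiodic_the_shift)+

end
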